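(* Let $\Lambda \leq \Gamma$ be a commensurated subgroup of a discrete countable group and let $\Gamma \curvearrowright (X, \mu)$ be a free pmp action on a standard probability space such that the action $\Lambda \curvearrowright (X, \mu)$ is aperiodic. Then the inclusion $\mathcal{R}(\Lambda \curvearrowright X) \subset \mathcal{R}(\Gamma \curvearrowright X)$ is aperiodic and $$H\big(\mathcal{R}(\Lambda \curvearrowright X) \subset \mathcal{R}(\Gamma \curvearrowright X)\big) \cong \Gamma /\!/ \Lambda$$ as topological groups.
   Context: All sets and maps are Borel and relations hold up to measure zero. The orbit equivalence relation of a pmp action is $\mathcal{R}(\Gamma \curvearrowright X) = \{(x,y) : y \in \Gamma\cdot x\}$. A pmp action of a group is aperiodic if every finite index subgroup acts ergodically. A subgroup $\Lambda \leq \Gamma$ is commensurated if $g \Lambda g^{-1} \cap \Lambda$ has finite index in $\Lambda$ for every $g \in \Gamma$. In that case $\Gamma /\!/ \Lambda$ (the relative profinite completion) is the closure of $\tau_{\Gamma,\Lambda}(\Gamma)$ in $\mathrm{Sym}(\Gamma/\Lambda)$ (topology of pointwise convergence), where $\tau_{\Gamma,\Lambda} : \Gamma \to \mathrm{Sym}(\Gamma/\Lambda)$ is induced by left multiplication. A pmp equivalence relation $\mathcal{R}$ on a standard probability space $(X,\mu)$ is a countable Borel equivalence relation such that every Borel automorphism of $X$ with graph contained in $\mathcal{R}$ preserves $\mu$; these automorphisms form the full group $[\mathcal{R}]$. $\mathcal{R}$ is ergodic if every $\mathcal{R}$-invariant Borel set has measure $0$ or $1$. The measure $\nu$ on $\mathcal{R}$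 is $\nu(\mathcal{V}) = \int_X |\{y : (x,y) \in \mathcal{V}\}|\,d\mu(x)$. A $1$-cocycle for $\mathcal{R}$ with values in a topological group $G$ is a Borel map $\Omega : \mathcal{R} \to G$ with $\Omega(x,z) = \Omega(x,y)\Omega(y,z)$ for almost every $(x,y,z)$ with $(x,y),(y,z) \in \mathcal{R}$. A Polish group is non-Archimedian if it has a neighbourhood basis of the identity consisting of open subgroups; e.g. $\mathrm{Sym}(I)$, for $I$ countable, with pointwise convergence. A $1$-cocycle $\Omega : \mathcal{R} \to G$ with values in a non-Archimedian Polish group is ergodic for $\mathcal{R}$ if for every open subgroup $K \leq G$ the subequivalence relation $\{(x,y) \in \mathcal{R} : \Omega(x,y) \in K\}$ has the same invariant Borel sets (mod null sets) as $\mathcal{R}$. If $\mathcal{R}$ is ergodic and $\Omega$ is an ergodic $1$-cocycle, $H(\Omega) \leq G$ denotes the essential image of $\Omega$, i.e. the smallest closed subset $F \subset G$ with $\nu(\Omega^{-1}(G \setminus F)) = 0$; it is a closed subgroup of $G$. Index cocycles: for an inclusion $\mathcal{S} \subset \mathcal{R}$ of ergodic pmp equivalence relations on $(X,\mu)$, there is a countable family $(c_i)_{i \in I}$ in $[\mathcal{R}]$ such that $\mathrm{id}_X \in \{c_i\}_{i\in I}$ and $[x]_{\mathcal{R}} = \bigsqcup_{i \in I} [c_i(x)]_{\mathcal{S}}$ for almost every $x$. The associated index cocycle is the $1$-cocycle $\Omega : \mathcal{R} \to \mathrm{Sym}(I)$ given by $\Omega(x,y)(i) = j \Leftrightarrow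 [c_j(x)]_{\mathcal{S}} = [c_i(y)]_{\mathcal{S}}$. The inclusion $\mathcal{S} \subset \mathcal{R}$ is called aperiodic if it admits an ergodic index cocycle $\Omega$; then $H(\mathcal{S} \subset \mathcal{R}) := H(\Omega)$ for some (or any) ergodic index cocycle $\Omega$, which is well defined up to conjugacy in $\mathrm{Sym}(I)$. *)

theory Defs
  imports "HOL-Probability.Probability" "HOL-Algebra.Left_Coset" "HOL-Algebra.Group_Action"
begin

section \<open>Topological groups and Sym(I)\<close>

definition topological_group :: "('g, 'b) monoid_scheme \<Rightarrow> 'g topology \<Rightarrow> bool" where
  "topological_group G T \<longleftrightarrow>
     group G \<and> topspace T = carrier G \<and>
     continuous_map (prod_topology T T) T (\<lambda>(x, y). x \<otimes>\<^bsub>G\<^esub> y) \<and>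
     continuous_map T T (\<lambda>x. inv\<^bsub>G\<^esub> x)"

definition topological_group_isomorphic ::
    "('g, 'b) monoid_scheme \<Rightarrow> 'g topology \<Rightarrow> ('h, 'c) monoid_scheme \<Rightarrow> 'h topology \<Rightarrow> bool" where
  "topological_group_isomorphic G T H T' \<longleftrightarrow>
     topological_group G T \<and> topological_group H T' \<and>
     (\<exists>f \<in> iso G H. homeomorphic_map T T' f)"

text \<open>The group \<^term>\<open>BijGroup I\<close> plays the role of Sym(I); its elements are extensional, so they
  are points of the product of copies of the discrete space \<^term>\<open>I\<close>, indexed by \<^term>\<open>I\<close>.\<close>

definition Sym_topology :: "'i set \<Rightarrow> ('i \<Rightarrow> 'i) topology" where
  "Sym_topology I =
     subtopology (product_topology (\<lambda>_. discrete_topology I) I) (carrier (BijGroup I))"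

definition borel_of_topology :: "'a topology \<Rightarrow> 'a measure" where
  "borel_of_topology T = sigma (topspace T) {U. openin T U}"


section \<open>Commensurated subgroups and the relative profinite completion\<close>

abbreviation restrict_group :: "('g, 'b) monoid_scheme \<Rightarrow> 'g set \<Rightarrow> ('g, 'b) monoid_scheme" where
  "restrict_group G H \<equiv> G \<lparr>carrier := H\<rparr>"

definition finite_index :: "('g, 'b) monoid_scheme \<Rightarrow> 'g set \<Rightarrow> bool" where
  "finite_index G H \<longleftrightarrow> subgroup H G \<and> finite (rcosets\<^bsub>G\<^esub> H)"

definition commensurated :: "('g, 'b) monoid_scheme \<Rightarrow> 'g set \<Rightarrow> bool" where
  "commensurated G L \<longleftrightarrow>
     subgroup L G \<and>
     (\<forall>g \<in> carrier G.
        finite_index (restrict_group G L) (((g <#\<^bsub>G\<^esub> L) #>\<^bsub>G\<^esub> inv\<^bsub>G\<^esub> g) \<inter> L))"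

definition left_mult_perm :: "('g, 'b) monoid_scheme \<Rightarrow> 'g set \<Rightarrow> 'g \<Rightarrow> ('g set \<Rightarrow> 'g set)" where
  "left_mult_perm G L g = (\<lambda>C \<in> lcosets\<^bsub>G\<^esub> L. g <#\<^bsub>G\<^esub> C)"

definition relative_profinite_completion ::
    "('g, 'b) monoid_scheme \<Rightarrow> 'g set \<Rightarrow> ('g set \<Rightarrow> 'g set) set" where
  "relative_profinite_completion G L =
     Sym_topology (lcosets\<^bsub>G\<^esub> L) closure_of (left_mult_perm G L ` carrier G)"


section \<open>Probability measure preserving actions\<close>

definition standard_prob_space :: "'x measure \<Rightarrow> bool" where
  "standard_prob_space M \<longleftrightarrow>
     prob_space M \<and>
     (\<exists>T. completely_metrizable_space T \<and> second_countable T \<and>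
          space M = topspace T \<and> sets M = sets (borel_of_topology T))"

definition pmp_action ::
    "'x measure \<Rightarrow> ('g, 'b) monoid_scheme \<Rightarrow> ('g \<Rightarrow> 'x \<Rightarrow> 'x) \<Rightarrow> bool" where
  "pmp_action M G \<phi> \<longleftrightarrow>
     group_action G (space M) \<phi> \<and>
     (\<forall>g \<in> carrier G. \<phi> g \<in> measurable M M \<and> distr M M (\<phi> g) = M)"

definition free_action ::
    "'x measure \<Rightarrow> ('g, 'b) monoid_scheme \<Rightarrow> ('g \<Rightarrow> 'x \<Rightarrow> 'x) \<Rightarrow> bool" where
  "free_action M G \<phi> \<longleftrightarrow> (AE x in M. stabilizer G \<phi> x = {\<one>\<^bsub>G\<^esub>})"

definition ergodic_action ::
    "'x measure \<Rightarrow> ('g, 'b) monoid_scheme \<Rightarrow> ('g \<Rightarrow> 'x \<Rightarrow> 'x) \<Rightarrow> bool" where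
  "ergodic_action M G \<phi> \<longleftrightarrow>
     (\<forall>A \<in> sets M. (\<forall>g \<in> carrier G. AE x in M. \<phi> g x \<in> A \<longleftrightarrow> x \<in> A) \<longrightarrow>
        measure M A = 0 \<or> measure M A = 1)"

definition aperiodic_action ::
    "'x measure \<Rightarrow> ('g, 'b) monoid_scheme \<Rightarrow> ('g \<Rightarrow> 'x \<Rightarrow> 'x) \<Rightarrow> bool" where
  "aperiodic_action M G \<phi> \<longleftrightarrow>
     (\<forall>H. finite_index G H \<longrightarrow> ergodic_action M (restrict_group G H) \<phi>)"

definition orbit_relation ::
    "'x measure \<Rightarrow> ('g, 'b) monoid_scheme \<Rightarrow> ('g \<Rightarrow> 'x \<Rightarrow> 'x) \<Rightarrow> ('x \<times> 'x) set" where
  "orbit_relation M G \<phi> = {(x, y). x \<in> space M \<and> y \<in> orbit G \<phi> x}"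


section \<open>Probability measure preserving equivalence relations\<close>

definition borel_automorphism :: "'x measure \<Rightarrow> ('x \<Rightarrow> 'x) \<Rightarrow> bool" where
  "borel_automorphism M f \<longleftrightarrow>
     bij_betw f (space M) (space M) \<and> f \<in> measurable M M \<and>
     the_inv_into (space M) f \<in> measurable M M"

definition full_group :: "'x measure \<Rightarrow> ('x \<times> 'x) set \<Rightarrow> ('x \<Rightarrow> 'x) set" where
  "full_group M R = {f. borel_automorphism M f \<and> (\<forall>x \<in> space M. (x, f x) \<in> R)}"

definition pmp_equiv_rel :: "'x measure \<Rightarrow> ('x \<times> 'x) set \<Rightarrow> bool" where
  "pmp_equiv_rel M R \<longleftrightarrow>
     standard_prob_space M \<and> equiv (space M) R \<and> R \<in> sets (M \<Otimes>\<^sub>M M) \<and>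
     (\<forall>x \<in> space M. countable (R `` {x})) \<and>
     (\<forall>f \<in> full_group M R. distr M M f = M)"

text \<open>Invariance is understood modulo null sets. This makes sense for an arbitrary subset
  \<^term>\<open>S\<close> of a pmp equivalence relation; it is used below for the sets of pairs on which a cocycle
  takes values in an open subgroup, which are equivalence relations only up to a null set.\<close>

definition invariant_sets :: "'x measure \<Rightarrow> ('x \<times> 'x) set \<Rightarrow> 'x set set" where
  "invariant_sets M S =
     {A \<in> sets M. AE x in M. \<forall>y. (x, y) \<in> S \<longrightarrow> (x \<in> A \<longleftrightarrow> y \<in> A)}"

definition ergodic_rel :: "'x measure \<Rightarrow> ('x \<times> 'x) set \<Rightarrow> bool" where
  "ergodic_rel M R \<longleftrightarrow> (\<forall>A \<in> invariant_sets M R. measure M A = 0 \<or> measure M A = 1)"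

text \<open>The measure \<open>\<nu>\<close> on Borel subsets of a pmp equivalence relation.\<close>

definition rel_measure :: "'x measure \<Rightarrow> ('x \<times> 'x) set \<Rightarrow> ennreal" where
  "rel_measure M V = (\<integral>\<^sup>+ x. emeasure (count_space UNIV) {y. (x, y) \<in> V} \<partial>M)"


section \<open>Cocycles\<close>

text \<open>A property holds for almost every composable pair in \<^term>\<open>R\<close> iff, for almost every
  \<^term>\<open>x\<close>, it holds for all \<^term>\<open>y\<close> and \<^term>\<open>z\<close>, since the classes are countable.\<close>

definition cocycle ::
    "'x measure \<Rightarrow> ('x \<times> 'x) set \<Rightarrow> ('g, 'b) monoid_scheme \<Rightarrow> 'g topology \<Rightarrow>
     ('x \<times> 'x \<Rightarrow> 'g) \<Rightarrow> bool" where
  "cocycle M R G T \<Omega> \<longleftrightarrow>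
     \<Omega> \<in> measurable (restrict_space (M \<Otimes>\<^sub>M M) R) (borel_of_topology T) \<and>
     (AE x in M. \<forall>y z. (x, y) \<in> R \<longrightarrow> (y, z) \<in> R \<longrightarrow> \<Omega> (x, z) = \<Omega> (x, y) \<otimes>\<^bsub>G\<^esub> \<Omega> (y, z))"

definition ergodic_cocycle ::
    "'x measure \<Rightarrow> ('x \<times> 'x) set \<Rightarrow> ('g, 'b) monoid_scheme \<Rightarrow> 'g topology \<Rightarrow>
     ('x \<times> 'x \<Rightarrow> 'g) \<Rightarrow> bool" where
  "ergodic_cocycle M R G T \<Omega> \<longleftrightarrow>
     cocycle M R G T \<Omega> \<and>
     (\<forall>K. subgroup K G \<and> openin T K \<longrightarrow>
        invariant_sets M {p \<in> R. \<Omega> p \<in> K} = invariant_sets M R)"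

definition essential_image ::
    "'x measure \<Rightarrow> ('x \<times> 'x) set \<Rightarrow> 'g topology \<Rightarrow> ('x \<times> 'x \<Rightarrow> 'g) \<Rightarrow> 'g set" where
  "essential_image M R T \<Omega> =
     (LEAST F. closedin T F \<and> rel_measure M {p \<in> R. \<Omega> p \<in> topspace T - F} = 0)"


section \<open>Index cocycles and aperiodic inclusions\<close>

definition index_family ::
    "'x measure \<Rightarrow> ('x \<times> 'x) set \<Rightarrow> ('x \<times> 'x) set \<Rightarrow> 'i set \<Rightarrow> ('i \<Rightarrow> 'x \<Rightarrow> 'x) \<Rightarrow> bool" where
  "index_family M S R I c \<longleftrightarrow>
     countable I \<and> (\<forall>i \<in> I. c i \<in> full_group M R) \<and>
     (\<exists>i \<in> I. AE x in M. c i x = x) \<and>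
     (AE x in M. R `` {x} = (\<Union>i\<in>I. S `` {c i x}) \<and> disjoint_family_on (\<lambda>i. S `` {c i x}) I)"

definition index_cocycle ::
    "'x measure \<Rightarrow> ('x \<times> 'x) set \<Rightarrow> ('x \<times> 'x) set \<Rightarrow> 'i set \<Rightarrow> ('i \<Rightarrow> 'x \<Rightarrow> 'x) \<Rightarrow>
     ('x \<times> 'x \<Rightarrow> 'i \<Rightarrow> 'i) \<Rightarrow> bool" where
  "index_cocycle M S R I c \<Omega> \<longleftrightarrow>
     index_family M S R I c \<and>
     cocycle M R (BijGroup I) (Sym_topology I) \<Omega> \<and>
     (AE x in M. \<forall>y. (x, y) \<in> R \<longrightarrow>
        (\<forall>i \<in> I. \<forall>j \<in> I. \<Omega> (x, y) i = j \<longleftrightarrow> S `` {c j x} = S `` {c i y}))"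

definition ergodic_index_cocycle ::
    "'x measure \<Rightarrow> ('x \<times> 'x) set \<Rightarrow> ('x \<times> 'x) set \<Rightarrow> 'i set \<Rightarrow> ('i \<Rightarrow> 'x \<Rightarrow> 'x) \<Rightarrow>
     ('x \<times> 'x \<Rightarrow> 'i \<Rightarrow> 'i) \<Rightarrow> bool" where
  "ergodic_index_cocycle M S R I c \<Omega> \<longleftrightarrow>
     index_cocycle M S R I c \<Omega> \<and> ergodic_cocycle M R (BijGroup I) (Sym_topology I) \<Omega>"

text \<open>Index sets are countable, so for existence it is enough to consider sets of natural numbers.\<close>

definition aperiodic_inclusion ::
    "'x measure \<Rightarrow> ('x \<times> 'x) set \<Rightarrow> ('x \<times> 'x) set \<Rightarrow> bool" where
  "aperiodic_inclusion M S R \<longleftrightarrow>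
     pmp_equiv_rel M S \<and> pmp_equiv_rel M R \<and> ergodic_rel M S \<and> ergodic_rel M R \<and> S \<subseteq> R \<and>
     (\<exists>(I :: nat set) c \<Omega>. ergodic_index_cocycle M S R I c \<Omega>)"

end

theory Submission
  imports Defs
begin

text \<open>
  Write \<open>J\<close> for the set of left cosets of \<open>\<Lambda>\<close> and \<open>\<tau>\<close> for the action of \<open>\<Gamma>\<close> on \<open>J\<close> by left
  translation. Fix a family \<open>c i\<close> of elements of the full group of \<open>\<R>(\<Gamma>)\<close> whose \<open>\<R>(\<Lambda>)\<close>-classes
  partition each \<open>\<R>(\<Gamma>)\<close>-class. At a point \<open>x\<close> with trivial stabilizer, \<open>c i x = g \<cdot> x\<close> for exactly one
  \<open>g\<close>, and the class of \<open>c i x\<close> is determined by the coset \<open>g\<inverse> \<Lambda>\<close>. Calling this coset \<open>\<theta>\<^sub>x i\<close> gives, for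
  almost every \<open>x\<close>, a bijection \<open>\<theta>\<^sub>x\<close> from the index set \<open>I\<close> to \<open>J\<close>, and the index cocycle becomes
  \<open>\<Omega>(x, h \<cdot> x) = \<theta>\<^sub>x\<inverse> \<circ> \<tau>(h\<inverse>) \<circ> \<theta>\<^bsub>h \<cdot> x\<^esub>\<close> (lemma \<open>label_cocycle\<close>): every index cocycle is cohomologous to
  \<open>(x, h \<cdot> x) \<mapsto> \<tau>(h\<inverse>)\<close>, by a transfer function \<open>\<theta>\<close> that may depend on \<open>x\<close>.

  Commensuration means that \<open>\<Lambda>\<close>-orbits on \<open>J\<close> are finite. Hence the subgroup of \<open>\<Lambda>\<close> that fixes each of
  finitely many cosets has finite index in \<open>\<Lambda>\<close> (\<open>finite_index_stabilizer_of_cosets\<close>), and by aperiodicity it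
  acts ergodically. Both halves of the proof rest on the ergodicity of these stabilizers.

  For existence, \<open>c i\<close> is taken to be the action of the inverse of a coset representative. Then \<open>\<theta>\<close> is
  constant, and the relation on which \<open>\<Omega>\<close> lies in an open subgroup contains the orbit relation of such a
  finite-index stabilizer, so all its invariant sets are trivial
  (\<open>invariant_sets_of_constant_conjugacy\<close>).

  For the essential image, fix an arbitrary ergodic index cocycle and a generic point \<open>x0\<close>. If \<open>\<Omega>(x, y)\<close>
  fixes a finite set \<open>F\<close> of indices, then \<open>\<theta>\<^sub>x\<close> and \<open>\<theta>\<^sub>y\<close> restricted to \<open>F\<close> differ by a translation of \<open>J\<close>;
  ergodicity of \<open>\<Omega>\<close> therefore makes the \<open>\<Gamma>\<close>-orbit of \<open>\<theta>\<^sub>x\<close> restricted to \<open>F\<close> almost everywhere equal to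
  that of \<open>\<theta>\<^bsub>x0\<^esub>\<close> (\<open>AE_label_translate\<close>). Substituted into the formula for \<open>\<Omega>\<close>, this puts almost all values
  of \<open>\<Omega>\<close> in the conjugate of \<open>\<Gamma>//\<Lambda>\<close> by \<open>\<theta>\<^bsub>x0\<^esub>\<close> (\<open>AE_cocycle_in_conj_completion\<close>). Conversely, the points
  \<open>x\<close> at which \<open>\<theta>\<^sub>x\<close> agrees with \<open>\<theta>\<^bsub>x0\<^esub>\<close> on a given finite set have positive measure, and an ergodic
  finite-index stabilizer moves a non-null part of one such set into another; so every basic neighbourhood
  of every element of the conjugate is attained with positive measure (\<open>conj_completion_least\<close>). The
  essential image is thus exactly the conjugate, and conjugation by \<open>\<theta>\<^bsub>x0\<^esub>\<close> is the required isomorphism.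
\<close>


section \<open>The symmetric group of a set as a topological group\<close>

lemma carrier_BijGroup [simp]: "carrier (BijGroup I) = Bij I"
  by (simp add: BijGroup_def)

lemma mult_BijGroup:
  assumes "f \<in> Bij I" "g \<in> Bij I"
  shows "f \<otimes>\<^bsub>BijGroup I\<^esub> g = compose I f g"
  using assms by (simp add: BijGroup_def)

lemma mult_BijGroup_apply:
  assumes "f \<in> Bij I" "g \<in> Bij I" "i \<in> I"
  shows "(f \<otimes>\<^bsub>BijGroup I\<^esub> g) i = f (g i)"
  using assms by (simp add: mult_BijGroup compose_eq)

lemma Bij_apply: "f \<in> Bij I \<Longrightarrow> i \<in> I \<Longrightarrow> f i \<in> I"
  by (auto simp: Bij_def bij_betw_def)

lemma inv_BijGroup_apply:
  assumes "f \<in> Bij I" "i \<in> I" "j \<in> I"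
  shows "(inv\<^bsub>BijGroup I\<^esub> f) i = j \<longleftrightarrow> f j = i"
  using assms by (auto simp: inv_BijGroup Bij_def bij_betw_def inv_into_f_f f_inv_into_f)

lemma Bij_eqI:
  assumes "f \<in> Bij I" "g \<in> Bij I" "\<And>i. i \<in> I \<Longrightarrow> f i = g i"
  shows "f = g"
  using assms by (intro extensionalityI[of f I g]) (auto simp: Bij_def)

lemma topspace_Sym_topology [simp]: "topspace (Sym_topology I) = Bij I"
  by (auto simp: Sym_topology_def Bij_def bij_betw_def PiE_def)

text \<open>The sets of permutations that agree with a given one on a finite set of points are a neighbourhood
  basis, so that density and closure questions become statements about finite sets of points.\<close>

lemma openin_Sym_topology_iff:
  "openin (Sym_topology I) U \<longleftrightarrow>
     U \<subseteq> Bij I \<and>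
     (\<forall>f\<in>U. \<exists>F. finite F \<and> F \<subseteq> I \<and> (\<forall>g\<in>Bij I. (\<forall>i\<in>F. g i = f i) \<longrightarrow> g \<in> U))"
  (is "?L \<longleftrightarrow> ?R")
proof
  assume ?L
  then obtain V where V: "openin (product_topology (\<lambda>_. discrete_topology I) I) V"
    and U: "U = V \<inter> Bij I"
    by (auto simp: Sym_topology_def openin_subtopology)
  have "\<exists>F. finite F \<and> F \<subseteq> I \<and> (\<forall>g\<in>Bij I. (\<forall>i\<in>F. g i = f i) \<longrightarrow> g \<in> U)" if "f \<in> U" for f
  proof -
    from V that U obtain W where W: "finite {i \<in> I. W i \<noteq> I}" "f \<in> Pi\<^sub>E I W" "Pi\<^sub>E I W \<subseteq> V"
      unfolding openin_product_topology_alt by fastforce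
    have "g \<in> U" if g: "g \<in> Bij I" "\<forall>i\<in>{i \<in> I. W i \<noteq> I}. g i = f i" for g
    proof -
      have "g i \<in> W i" if "i \<in> I" for i
        using W(2) g that Bij_apply[OF g(1) that] by (cases "W i = I") auto
      then have "g \<in> Pi\<^sub>E I W"
        using g(1) by (auto simp: Bij_def PiE_def)
      then show ?thesis using W(3) U g(1) by auto
    qed
    then show ?thesis using W(1) by (intro exI[of _ "{i \<in> I. W i \<noteq> I}"]) auto
  qed
  then show ?R using U by auto
next
  assume R: ?R
  have "\<exists>T. openin (Sym_topology I) T \<and> f \<in> T \<and> T \<subseteq> U" if f: "f \<in> U" for f
  proof -
    from R f obtain F where F: "finite F" "F \<subseteq> I" "\<forall>g\<in>Bij I. (\<forall>i\<in>F. g i = f i) \<longrightarrow> g \<in> U"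
      by blast
    have fB: "f \<in> Bij I" using R f by auto
    define W where "W = (\<lambda>i. if i \<in> F then {f i} else I)"
    have "openin (product_topology (\<lambda>_. discrete_topology I) I) (Pi\<^sub>E I W)"
      unfolding openin_PiE_gen
      using F(1,2) fB finite_subset[of "{i \<in> I. W i \<noteq> I}" F]
      by (auto simp: W_def Bij_apply split: if_splits)
    moreover have "f \<in> Pi\<^sub>E I W"
      using fB by (auto simp: W_def Bij_apply Bij_def PiE_def bij_betw_def)
    moreover have "Pi\<^sub>E I W \<inter> Bij I \<subseteq> U"
      using F by (auto simp: W_def PiE_iff split: if_splits)
         (metis (mono_tags) singletonD subsetD)
    ultimately show ?thesis
      using fB by (intro exI[of _ "Pi\<^sub>E I W \<inter> Bij I"])
        (auto simp: Sym_topology_def openin_subtopology)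
  qed
  then show ?L
    by (subst openin_subopen) blast
qed

lemma openin_Sym_topology_eval:
  assumes "i \<in> I"
  shows "openin (Sym_topology I) {f \<in> Bij I. f i = j}"
  unfolding openin_Sym_topology_iff using assms
  by (auto intro!: exI[of _ "{i}"])

lemma openin_pointwise_stabilizer:
  assumes "finite F" "F \<subseteq> I"
  shows "openin (Sym_topology I) {f \<in> Bij I. \<forall>i\<in>F. f i = i}"
  unfolding openin_Sym_topology_iff using assms
  by (auto intro!: exI[of _ F])

lemma subgroup_pointwise_stabilizer:
  assumes "F \<subseteq> I"
  shows "subgroup {f \<in> Bij I. \<forall>i\<in>F. f i = i} (BijGroup I)"
proof -
  interpret group "BijGroup I" by (rule group_BijGroup)
  have inv: "inv\<^bsub>BijGroup I\<^esub> f \<in> Bij I" if "f \<in> Bij I" for f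
    using that inv_closed by simp
  show ?thesis
  proof (rule subgroupI)
    show "{f \<in> Bij I. \<forall>i\<in>F. f i = i} \<noteq> {}"
      using assms id_Bij[of I] by fastforce
  next
    fix f assume f: "f \<in> {f \<in> Bij I. \<forall>i\<in>F. f i = i}"
    then show "inv\<^bsub>BijGroup I\<^esub> f \<in> {f \<in> Bij I. \<forall>i\<in>F. f i = i}"
      using assms inv[of f] by (auto simp: inv_BijGroup_apply subsetD)
  next
    fix f g assume "f \<in> {f \<in> Bij I. \<forall>i\<in>F. f i = i}" "g \<in> {f \<in> Bij I. \<forall>i\<in>F. f i = i}"
    then show "f \<otimes>\<^bsub>BijGroup I\<^esub> g \<in> {f \<in> Bij I. \<forall>i\<in>F. f i = i}"
      using assms m_closed[of f g] by (auto simp: mult_BijGroup_apply subsetD)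
  qed auto
qed

text \<open>Continuity may be tested on the evaluations at single points; these take values in a discrete
  space, so only their fibres matter.\<close>

lemma continuous_map_Sym_topologyI:
  assumes "f \<in> topspace X \<rightarrow> Bij I"
    and "\<And>i j. i \<in> I \<Longrightarrow> j \<in> I \<Longrightarrow> openin X {x \<in> topspace X. f x i = j}"
  shows "continuous_map X (Sym_topology I) f"
proof -
  have "openin X {x \<in> topspace X. f x i \<in> U}" if "i \<in> I" "U \<subseteq> I" for i U
  proof -
    have eq: "{x \<in> topspace X. f x i \<in> U} = (\<Union>j\<in>U. {x \<in> topspace X. f x i = j})"
      by auto
    have "openin X {x \<in> topspace X. f x i = j}" if "j \<in> U" for j
      using assms(2)[of i j] \<open>i \<in> I\<close> \<open>U \<subseteq> I\<close> that by blast
    then have "openin X (\<Union>j\<in>U. {x \<in> topspace X. f x i = j})"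
      by (intro openin_Union) auto
    with eq show ?thesis by (simp only:)
  qed
  moreover have B: "f x \<in> Bij I" if "x \<in> topspace X" for x
    using assms(1) that by auto
  ultimately have "continuous_map X (discrete_topology I) (\<lambda>x. f x i)" if "i \<in> I" for i
    using that by (simp add: continuous_map_def Bij_apply)
  then have "continuous_map X (product_topology (\<lambda>_. discrete_topology I) I) f"
    using B by (force simp: continuous_map_componentwise Bij_def)
  then show ?thesis
    using assms(1) by (simp add: Sym_topology_def continuous_map_in_subtopology image_subset_iff_funcset)
qed

lemma topological_group_Sym: "topological_group (BijGroup I) (Sym_topology I)"
proof -
  interpret group "BijGroup I" by (rule group_BijGroup)
  let ?T = "Sym_topology I"
  have "openin (prod_topology ?T ?T) {x \<in> topspace (prod_topology ?T ?T). (\<lambda>(x, y). x \<otimes>\<^bsub>BijGroup I\<^esub> y) x i = j}"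
    if "i \<in> I" for i j
  proof -
    \<comment> \<open>the intermediate point \<open>k\<close> of the composite \<open>i \<mapsto> k \<mapsto> j\<close> decomposes the fibre into open boxes\<close>
    have "{x \<in> topspace (prod_topology ?T ?T). (\<lambda>(x, y). x \<otimes>\<^bsub>BijGroup I\<^esub> y) x i = j} =
        (\<Union>k\<in>I. {f \<in> Bij I. f k = j} \<times> {f \<in> Bij I. f i = k})"
      using that by (auto simp: mult_BijGroup_apply Bij_apply)
    then show ?thesis
      using that openin_Sym_topology_eval by (auto simp: openin_prod_Times_iff intro!: openin_Union)
  qed
  moreover have "openin ?T {f \<in> topspace ?T. (inv\<^bsub>BijGroup I\<^esub> f) i = j}" if "i \<in> I" "j \<in> I" for i j
  proof -
    have "{f \<in> topspace ?T. (inv\<^bsub>BijGroup I\<^esub> f) i = j} = {f \<in> Bij I. f j = i}"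
      using inv_BijGroup_apply[OF _ that] by (intro Set.Collect_cong) (simp cong: conj_cong)
    then show ?thesis using openin_Sym_topology_eval that by simp
  qed
  ultimately show ?thesis
    unfolding topological_group_def
    using inv_closed m_closed is_group
    by (auto intro!: continuous_map_Sym_topologyI)
qed

lemma topological_group_subgroup:
  assumes "topological_group G T" "subgroup H G"
  shows "topological_group (restrict_group G H) (subtopology T H)"
proof -
  have G: "group G" "topspace T = carrier G" using assms by (auto simp: topological_group_def)
  interpret group G by fact
  interpret H: subgroup H G by fact
  have m: "continuous_map (prod_topology T T) T (\<lambda>(x, y). x \<otimes>\<^bsub>G\<^esub> y)"
    and i: "continuous_map T T (\<lambda>x. inv\<^bsub>G\<^esub> x)"
    using assms by (auto simp: topological_group_def)
  have "continuous_map (subtopology T H) (subtopology T H) (\<lambda>x. inv\<^bsub>G\<^esub> x)"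
    by (auto simp: continuous_map_in_subtopology continuous_map_from_subtopology[OF i])
  then have "continuous_map (subtopology T H) (subtopology T H) (\<lambda>x. inv\<^bsub>restrict_group G H\<^esub> x)"
    by (rule continuous_map_eq) (auto simp: m_inv_consistent[OF assms(2)])
  moreover have "continuous_map (subtopology (prod_topology T T) (H \<times> H)) (subtopology T H) (\<lambda>(x, y). x \<otimes>\<^bsub>G\<^esub> y)"
    by (auto simp: continuous_map_in_subtopology continuous_map_from_subtopology[OF m])
  ultimately show ?thesis
    using subgroup_imp_group[OF assms(2)] H.subset G(2)
    by (simp add: topological_group_def subtopology_Times Int_absorb1)
qed

lemma openin_cylinder:
  assumes F: "finite F" "F \<subseteq> I"
  shows "openin (Sym_topology I) {g \<in> Bij I. \<forall>i\<in>F. g i = f i}"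
  unfolding openin_Sym_topology_iff
proof (intro conjI ballI)
  fix h assume "h \<in> {g \<in> Bij I. \<forall>i\<in>F. g i = f i}"
  then have "\<forall>g\<in>Bij I. (\<forall>i\<in>F. g i = h i) \<longrightarrow> g \<in> {g \<in> Bij I. \<forall>i\<in>F. g i = f i}"
    by simp
  then show "\<exists>E. finite E \<and> E \<subseteq> I \<and>
      (\<forall>g\<in>Bij I. (\<forall>i\<in>E. g i = h i) \<longrightarrow> g \<in> {g \<in> Bij I. \<forall>i\<in>F. g i = f i})"
    using F by blast
qed auto

lemma closure_of_Sym_topology:
  assumes "A \<subseteq> Bij I"
  shows "(Sym_topology I) closure_of A =
    {f \<in> Bij I. \<forall>F. finite F \<longrightarrow> F \<subseteq> I \<longrightarrow> (\<exists>a\<in>A. \<forall>i\<in>F. a i = f i)}" (is "?C = ?D")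
proof
  show "?C \<subseteq> ?D"
  proof
    fix f assume f: "f \<in> ?C"
    then have fB: "f \<in> Bij I" by (simp add: in_closure_of)
    have "\<exists>a\<in>A. \<forall>i\<in>F. a i = f i" if F: "finite F" "F \<subseteq> I" for F
    proof -
      let ?U = "{g \<in> Bij I. \<forall>i\<in>F. g i = f i}"
      have "openin (Sym_topology I) ?U"
        using F by (rule openin_cylinder)
      moreover have "f \<in> ?U" using fB by simp
      ultimately obtain a where "a \<in> A" "a \<in> ?U"
        using f[unfolded in_closure_of, THEN conjunct2, rule_format, of ?U] by blast
      then show ?thesis by auto
    qed
    then show "f \<in> ?D" using fB by simp
  qed
  show "?D \<subseteq> ?C"
  proof
    fix f assume f: "f \<in> ?D"
    have "\<exists>y. y \<in> A \<and> y \<in> U" if U: "f \<in> U" "openin (Sym_topology I) U" for U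
    proof -
      obtain F where F: "finite F" "F \<subseteq> I" "\<forall>g\<in>Bij I. (\<forall>i\<in>F. g i = f i) \<longrightarrow> g \<in> U"
        using bspec[OF conjunct2[OF openin_Sym_topology_iff[THEN iffD1, OF U(2)]] U(1)] by (elim exE conjE)
      moreover obtain a where "a \<in> A" "\<forall>i\<in>F. a i = f i"
        using f[THEN CollectD, THEN conjunct2, rule_format, OF F(1,2)] by (elim bexE)
      moreover have "a \<in> Bij I" using \<open>a \<in> A\<close> assms by auto
      ultimately have "a \<in> U" by simp
      with \<open>a \<in> A\<close> show ?thesis by blast
    qed
    then show "f \<in> ?C"
      using f by (simp add: in_closure_of)
  qed
qed

lemma subgroup_closure_of_Sym_topology:
  assumes "subgroup A (BijGroup I)"
  shows "subgroup (Sym_topology I closure_of A) (BijGroup I)"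
proof -
  interpret group "BijGroup I" by (rule group_BijGroup)
  interpret A: subgroup A "BijGroup I" by fact
  have A: "A \<subseteq> Bij I" using A.subset by simp
  have inv: "inv\<^bsub>BijGroup I\<^esub> f \<in> Bij I" if "f \<in> Bij I" for f
    using that inv_closed by simp
  let ?C = "Sym_topology I closure_of A"
  have AC: "A \<subseteq> ?C" by (rule closure_of_subset) (simp add: A)
  show ?thesis
  proof (rule subgroupI)
    show "?C \<subseteq> carrier (BijGroup I)"
      using closure_of_subset_topspace[of "Sym_topology I"] by simp
    show "?C \<noteq> {}"
      using AC A.one_closed by blast
  next
    fix f assume f: "f \<in> ?C"
    then have fB: "f \<in> Bij I" by (auto simp: in_closure_of)
    have "\<exists>a\<in>A. \<forall>i\<in>F. a i = (inv\<^bsub>BijGroup I\<^esub> f) i" if F: "finite F" "F \<subseteq> I" for F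
    proof -
      \<comment> \<open>inverses agree on \<open>F\<close> as soon as the permutations agree on the preimage of \<open>F\<close>\<close>
      let ?E = "(inv\<^bsub>BijGroup I\<^esub> f) ` F"
      have "finite ?E" "?E \<subseteq> I" using F Bij_apply[OF inv[OF fB]] by auto
      then obtain a where a: "a \<in> A" "\<forall>i\<in>?E. a i = f i"
        using f unfolding closure_of_Sym_topology[OF A] by blast
      have "(inv\<^bsub>BijGroup I\<^esub> a) i = (inv\<^bsub>BijGroup I\<^esub> f) i" if "i \<in> F" for i
      proof -
        have "a ((inv\<^bsub>BijGroup I\<^esub> f) i) = f ((inv\<^bsub>BijGroup I\<^esub> f) i)" using a that by auto
        also have "\<dots> = i"
          using inv_BijGroup_apply[OF fB, of i "(inv\<^bsub>BijGroup I\<^esub> f) i"] Bij_apply[OF inv[OF fB]] that F(2) by auto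
        finally show ?thesis
          using inv_BijGroup_apply[of a I i "(inv\<^bsub>BijGroup I\<^esub> f) i"] a(1) A Bij_apply[OF inv[OF fB]] that F(2) by auto
      qed
      then show ?thesis using a(1) A.m_inv_closed by blast
    qed
    then show "inv\<^bsub>BijGroup I\<^esub> f \<in> ?C"
      unfolding closure_of_Sym_topology[OF A] using inv[OF fB] by blast
  next
    fix f g assume f: "f \<in> ?C" and g: "g \<in> ?C"
    then have B: "f \<in> Bij I" "g \<in> Bij I" by (auto simp: in_closure_of)
    have "\<exists>a\<in>A. \<forall>i\<in>F. a i = (f \<otimes>\<^bsub>BijGroup I\<^esub> g) i" if F: "finite F" "F \<subseteq> I" for F
    proof -
      obtain b where b: "b \<in> A" "\<forall>i\<in>F. b i = g i"
        using g F unfolding closure_of_Sym_topology[OF A] by blast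
      have "finite (g ` F)" "g ` F \<subseteq> I" using F Bij_apply[OF B(2)] by auto
      then obtain a where a: "a \<in> A" "\<forall>i\<in>g ` F. a i = f i"
        using f unfolding closure_of_Sym_topology[OF A] by blast
      have "(a \<otimes>\<^bsub>BijGroup I\<^esub> b) i = (f \<otimes>\<^bsub>BijGroup I\<^esub> g) i" if "i \<in> F" for i
      proof -
        have "a \<in> Bij I" "b \<in> Bij I" "i \<in> I" using a(1) b(1) A F(2) that by auto
        then show ?thesis using a(2) b(2) that B by (simp add: mult_BijGroup_apply)
      qed
      then show ?thesis using a(1) b(1) A.m_closed by blast
    qed
    then show "f \<otimes>\<^bsub>BijGroup I\<^esub> g \<in> ?C"
      unfolding closure_of_Sym_topology[OF A] using m_closed[of f g] B by simp
  qed
qed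

definition conj_bij :: "'i set \<Rightarrow> 'j set \<Rightarrow> ('i \<Rightarrow> 'j) \<Rightarrow> ('i \<Rightarrow> 'i) \<Rightarrow> ('j \<Rightarrow> 'j)" where
  "conj_bij I J \<theta> f = (\<lambda>j\<in>J. \<theta> (f (inv_into I \<theta> j)))"

context
  fixes I :: "'i set" and J :: "'j set" and \<theta> :: "'i \<Rightarrow> 'j"
  assumes bij: "bij_betw \<theta> I J"
begin

lemma theta_in: "i \<in> I \<Longrightarrow> \<theta> i \<in> J"
  and inv_theta_in: "j \<in> J \<Longrightarrow> inv_into I \<theta> j \<in> I"
  and theta_of_inv_theta: "j \<in> J \<Longrightarrow> \<theta> (inv_into I \<theta> j) = j"
  and inv_theta_of_theta: "i \<in> I \<Longrightarrow> inv_into I \<theta> (\<theta> i) = i"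
  using bij by (auto simp: bij_betw_def inv_into_into f_inv_into_f)

lemma conj_bij_Bij:
  assumes "f \<in> Bij I"
  shows "conj_bij I J \<theta> f \<in> Bij J"
proof -
  have "bij_betw (\<theta> \<circ> (f \<circ> inv_into I \<theta>)) J J"
    using assms bij bij_betw_inv_into[OF bij]
    by (intro bij_betw_trans[OF bij_betw_trans]) (auto simp: Bij_def)
  then have "bij_betw (conj_bij I J \<theta> f) J J"
    by (rule bij_betw_cong[THEN iffD1, rotated]) (simp add: conj_bij_def)
  then show ?thesis by (auto simp: Bij_def conj_bij_def)
qed

lemma conj_bij_theta: "i \<in> I \<Longrightarrow> conj_bij I J \<theta> f (\<theta> i) = \<theta> (f i)"
  by (simp add: conj_bij_def theta_in inv_theta_of_theta)

lemma conj_bij_mult: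
  assumes "f \<in> Bij I" "g \<in> Bij I"
  shows "conj_bij I J \<theta> (f \<otimes>\<^bsub>BijGroup I\<^esub> g) = conj_bij I J \<theta> f \<otimes>\<^bsub>BijGroup J\<^esub> conj_bij I J \<theta> g"
proof (rule Bij_eqI)
  have fg: "f \<otimes>\<^bsub>BijGroup I\<^esub> g \<in> Bij I"
    using assms by (simp add: mult_BijGroup compose_Bij)
  show "conj_bij I J \<theta> (f \<otimes>\<^bsub>BijGroup I\<^esub> g) \<in> Bij J"
    using fg by (rule conj_bij_Bij)
  show "conj_bij I J \<theta> f \<otimes>\<^bsub>BijGroup J\<^esub> conj_bij I J \<theta> g \<in> Bij J"
    using assms conj_bij_Bij by (simp add: mult_BijGroup compose_Bij)
  fix j assume "j \<in> J"
  then show "conj_bij I J \<theta> (f \<otimes>\<^bsub>BijGroup I\<^esub> g) j = (conj_bij I J \<theta> f \<otimes>\<^bsub>BijGroup J\<^esub> conj_bij I J \<theta> g) j"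
    using assms conj_bij_Bij
    by (simp add: mult_BijGroup_apply)
       (simp add: conj_bij_def mult_BijGroup_apply inv_theta_in theta_in inv_theta_of_theta Bij_apply)
qed

lemma continuous_map_conj_bij:
  "continuous_map (Sym_topology I) (Sym_topology J) (conj_bij I J \<theta>)"
proof (rule continuous_map_Sym_topologyI)
  show "conj_bij I J \<theta> \<in> topspace (Sym_topology I) \<rightarrow> Bij J"
    using conj_bij_Bij by auto
next
  fix i j assume ij: "i \<in> J" "j \<in> J"
  have "{f \<in> topspace (Sym_topology I). conj_bij I J \<theta> f i = j} =
      {f \<in> Bij I. f (inv_into I \<theta> i) = inv_into I \<theta> j}"
    using ij by (auto simp: conj_bij_def inv_theta_in inv_theta_of_theta theta_of_inv_theta Bij_apply)
  then show "openin (Sym_topology I) {f \<in> topspace (Sym_topology I). conj_bij I J \<theta> f i = j}"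
    using openin_Sym_topology_eval inv_theta_in[OF ij(1)] by simp
qed

end

lemma conj_bij_inverse:
  assumes bij: "bij_betw \<theta> I J" and f: "f \<in> Bij I"
  shows "conj_bij J I (inv_into I \<theta>) (conj_bij I J \<theta> f) = f"
proof (rule Bij_eqI[OF _ f])
  show "conj_bij J I (inv_into I \<theta>) (conj_bij I J \<theta> f) \<in> Bij I"
    by (intro conj_bij_Bij bij_betw_inv_into bij f)
  fix i assume i: "i \<in> I"
  have "inv_into J (inv_into I \<theta>) i = \<theta> i"
    using bij i by (metis bij_betw_inv_into bij_betwE bij_betw_inv_into_left)
  then show "conj_bij J I (inv_into I \<theta>) (conj_bij I J \<theta> f) i = f i"
    using i f bij by (simp add: conj_bij_def bij_betwE inv_theta_of_theta[OF bij] theta_in[OF bij] Bij_apply)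
qed

lemma conj_bij_inverse':
  assumes bij: "bij_betw \<theta> I J" and f: "f \<in> Bij J"
  shows "conj_bij I J \<theta> (conj_bij J I (inv_into I \<theta>) f) = f"
proof (rule Bij_eqI[OF _ f])
  have B: "conj_bij J I (inv_into I \<theta>) f \<in> Bij I"
    by (intro conj_bij_Bij bij_betw_inv_into bij f)
  show "conj_bij I J \<theta> (conj_bij J I (inv_into I \<theta>) f) \<in> Bij J"
    by (rule conj_bij_Bij[OF bij B])
  fix j assume j: "j \<in> J"
  have "inv_into J (inv_into I \<theta>) (inv_into I \<theta> j) = j"
    using bij j by (metis bij_betw_inv_into bij_betw_inv_into_left)
  then show "conj_bij I J \<theta> (conj_bij J I (inv_into I \<theta>) f) j = f j"
    using j f by (simp add: conj_bij_def inv_theta_in[OF bij] theta_of_inv_theta[OF bij] Bij_apply)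
qed

lemma homeomorphic_map_conj_bij:
  assumes "bij_betw \<theta> I J"
  shows "homeomorphic_map (Sym_topology I) (Sym_topology J) (conj_bij I J \<theta>)"
  unfolding homeomorphic_map_maps homeomorphic_maps_def
  using continuous_map_conj_bij[OF assms] continuous_map_conj_bij[OF bij_betw_inv_into[OF assms]]
    conj_bij_inverse[OF assms] conj_bij_inverse'[OF assms]
  by (intro exI[of _ "conj_bij J I (inv_into I \<theta>)"]) auto

text \<open>Conjugation by a bijection of the underlying sets identifies the two symmetric groups as topological
  groups, and hence any subgroup with its preimage.\<close>

lemma topological_group_isomorphic_conj:
  assumes bij: "bij_betw \<theta> I J" and H: "subgroup H (BijGroup J)"
  defines "H' \<equiv> {f \<in> Bij I. conj_bij I J \<theta> f \<in> H}"
  shows "topological_group_isomorphic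
    (restrict_group (BijGroup I) H') (subtopology (Sym_topology I) H')
    (restrict_group (BijGroup J) H) (subtopology (Sym_topology J) H)"
proof -
  have hom: "group_hom (BijGroup I) (BijGroup J) (conj_bij I J \<theta>)"
    using conj_bij_Bij[OF bij] conj_bij_mult[OF bij]
    by (intro group_hom.intro group_BijGroup group_hom_axioms.intro homI) auto
  interpret h: group_hom "BijGroup I" "BijGroup J" "conj_bij I J \<theta>" by (rule hom)
  interpret H: subgroup H "BijGroup J" by fact
  have HB: "H \<subseteq> Bij J" using H.subset by simp
  have H': "subgroup H' (BijGroup I)"
  proof (rule subgroup.intro)
    fix f g assume "f \<in> H'" "g \<in> H'"
    then show "f \<otimes>\<^bsub>BijGroup I\<^esub> g \<in> H'"
      using h.G.m_closed[of f g] by (auto simp: H'_def conj_bij_mult[OF bij])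
  next
    fix f assume "f \<in> H'"
    then show "inv\<^bsub>BijGroup I\<^esub> f \<in> H'"
      using h.G.inv_closed[of f] h.hom_inv[of f] by (auto simp: H'_def)
  qed (use h.G.one_closed h.hom_one in \<open>auto simp: H'_def\<close>)
  have img: "conj_bij I J \<theta> ` H' = H"
  proof
    show "H \<subseteq> conj_bij I J \<theta> ` H'"
    proof
      fix f assume f: "f \<in> H"
      then have "f \<in> Bij J" using HB by auto
      with f show "f \<in> conj_bij I J \<theta> ` H'"
        using conj_bij_inverse'[OF bij, of f] conj_bij_Bij[OF bij_betw_inv_into[OF bij], of f]
        by (intro image_eqI[of _ _ "conj_bij J I (inv_into I \<theta>) f"]) (auto simp: H'_def)
    qed
  qed (auto simp: H'_def)
  have inj: "inj_on (conj_bij I J \<theta>) H'"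
    by (rule inj_on_inverseI[of _ "conj_bij J I (inv_into I \<theta>)"])
       (auto simp: H'_def conj_bij_inverse[OF bij])
  have "conj_bij I J \<theta> \<in> iso (restrict_group (BijGroup I) H') (restrict_group (BijGroup J) H)"
    using img inj by (auto simp: iso_def bij_betw_def hom_def H'_def conj_bij_mult[OF bij])
  moreover have "homeomorphic_map (subtopology (Sym_topology I) H') (subtopology (Sym_topology J) H) (conj_bij I J \<theta>)"
  proof (rule homeomorphic_map_subtopologies[OF homeomorphic_map_conj_bij[OF bij]])
    have "topspace (Sym_topology I) \<inter> H' = H'" "topspace (Sym_topology J) \<inter> H = H"
      using HB by (auto simp: H'_def)
    then show "conj_bij I J \<theta> ` (topspace (Sym_topology I) \<inter> H') = topspace (Sym_topology J) \<inter> H"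
      using img by simp
  qed
  ultimately show ?thesis
    unfolding topological_group_isomorphic_def
    using topological_group_subgroup[OF topological_group_Sym H'] topological_group_subgroup[OF topological_group_Sym H]
    by blast
qed


section \<open>Translation of left cosets\<close>

\<comment> \<open>the symbol is used for left cosets only\<close>
no_notation subset_mset (infix \<open><#\<close> 50)

context group
begin

lemma lcosetsE:
  assumes "C \<in> lcosets L"
  obtains a where "a \<in> carrier G" "C = a <# L"
  using assms by (auto simp: LCOSETS_def)

lemma lcosetsI: "a \<in> carrier G \<Longrightarrow> a <# L \<in> lcosets L"
  by (auto simp: LCOSETS_def)

lemma lcos_eq_iff:
  assumes "subgroup L G" "a \<in> carrier G" "b \<in> carrier G"
  shows "a <# L = b <# L \<longleftrightarrow> inv a \<otimes> b \<in> L"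
proof
  assume "a <# L = b <# L"
  then show "inv a \<otimes> b \<in> L"
    using lcos_self[OF assms(3,1)] subgroup.lcos_module_imp[OF assms(1) is_group assms(2)] by auto
next
  assume "inv a \<otimes> b \<in> L"
  then have "b \<in> a <# L"
    using subgroup.lcos_module_rev[OF assms(1) is_group assms(2,3)] by simp
  then show "a <# L = b <# L"
    using l_repr_independence[OF _ assms(2,1)] by simp
qed

context
  fixes L assumes L: "subgroup L G"
begin

lemma lcos_translate:
  assumes "g \<in> carrier G" "a \<in> carrier G"
  shows "g <# (a <# L) = (g \<otimes> a) <# L"
  using assms L by (intro lcos_m_assoc) (auto simp: subgroup.subset)

lemma lcos_translate_mult:
  assumes "g \<in> carrier G" "h \<in> carrier G" "C \<in> lcosets L"
  shows "g <# (h <# C) = (g \<otimes> h) <# C"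
  using assms by (intro lcos_m_assoc subgroup.lcosets_carrier[OF L is_group])

lemma lcos_translate_one: "C \<in> lcosets L \<Longrightarrow> \<one> <# C = C"
  by (intro lcos_mult_one subgroup.lcosets_carrier[OF L is_group])

lemma lcos_translate_closed:
  assumes "g \<in> carrier G" "C \<in> lcosets L"
  shows "g <# C \<in> lcosets L"
  using assms by (auto simp: lcos_translate lcosetsI elim!: lcosetsE)

lemma lcos_translate_inv_eq:
  assumes "g \<in> carrier G" "C \<in> lcosets L" "D \<in> lcosets L"
  shows "inv g <# C = D \<longleftrightarrow> g <# D = C"
  using assms
  by (metis inv_closed l_inv r_inv lcos_translate_mult lcos_translate_one)

lemma left_mult_perm_Bij:
  assumes "g \<in> carrier G"
  shows "left_mult_perm G L g \<in> Bij (lcosets L)"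
proof -
  have "bij_betw (left_mult_perm G L g) (lcosets L) (lcosets L)"
    by (rule bij_betw_byWitness[where f' = "left_mult_perm G L (inv g)"])
       (use assms in \<open>auto simp: left_mult_perm_def lcos_translate_closed lcos_translate_mult lcos_translate_one\<close>)
  then show ?thesis by (auto simp: Bij_def left_mult_perm_def)
qed

lemma left_mult_perm_mult:
  assumes "g \<in> carrier G" "h \<in> carrier G"
  shows "left_mult_perm G L (g \<otimes> h) =
    left_mult_perm G L g \<otimes>\<^bsub>BijGroup (lcosets L)\<^esub> left_mult_perm G L h"
proof (rule Bij_eqI)
  show "left_mult_perm G L g \<otimes>\<^bsub>BijGroup (lcosets L)\<^esub> left_mult_perm G L h \<in> Bij (lcosets L)"
    using assms by (simp add: mult_BijGroup compose_Bij left_mult_perm_Bij)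
  fix C assume C: "C \<in> lcosets L"
  show "left_mult_perm G L (g \<otimes> h) C =
      (left_mult_perm G L g \<otimes>\<^bsub>BijGroup (lcosets L)\<^esub> left_mult_perm G L h) C"
    using assms C
    by (simp add: left_mult_perm_Bij mult_BijGroup_apply)
       (simp add: left_mult_perm_def lcos_translate_closed lcos_translate_mult)
qed (use assms left_mult_perm_Bij in auto)

lemma group_hom_left_mult_perm: "group_hom G (BijGroup (lcosets L)) (left_mult_perm G L)"
  using left_mult_perm_Bij left_mult_perm_mult
  by (intro group_hom.intro group_BijGroup group_hom_axioms.intro homI is_group) auto

lemma subgroup_relative_profinite_completion:
  "subgroup (relative_profinite_completion G L) (BijGroup (lcosets L))"
  unfolding relative_profinite_completion_def
  by (intro subgroup_closure_of_Sym_topology group_hom.img_is_subgroup group_hom_left_mult_perm)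

lemma mem_relative_profinite_completion_iff:
  "f \<in> relative_profinite_completion G L \<longleftrightarrow>
     f \<in> Bij (lcosets L) \<and>
     (\<forall>F. finite F \<longrightarrow> F \<subseteq> lcosets L \<longrightarrow> (\<exists>g\<in>carrier G. \<forall>C\<in>F. g <# C = f C))"
proof -
  have img: "left_mult_perm G L ` carrier G \<subseteq> Bij (lcosets L)"
    using left_mult_perm_Bij by auto
  have "(\<forall>C\<in>F. left_mult_perm G L g C = f C) \<longleftrightarrow> (\<forall>C\<in>F. g <# C = f C)" if "F \<subseteq> lcosets L" for F g
    using that by (intro ball_cong) (auto simp: left_mult_perm_def)
  then show ?thesis
    unfolding relative_profinite_completion_def closure_of_Sym_topology[OF img] by simp
qed

text \<open>The coset \<open>C = g L\<close> is fixed by \<open>N = g L g\<inverse> \<inter> L\<close>, so \<open>inv l <# C\<close> depends only on the right coset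
  \<open>N #> l\<close>; there are finitely many of these.\<close>

lemma finite_translates_of_commensurated:
  assumes comm: "commensurated G L" and C: "C \<in> lcosets L"
  shows "finite ((\<lambda>l. inv l <# C) ` L)"
proof -
  obtain g where g: "g \<in> carrier G" "C = g <# L" using C by (rule lcosetsE)
  define N where "N = ((g <# L) #> inv g) \<inter> L"
  have "finite_index (restrict_group G L) N"
    using comm g(1) by (auto simp: commensurated_def N_def)
  then have fin: "finite (rcosets\<^bsub>restrict_group G L\<^esub> N)" and N: "subgroup N (restrict_group G L)"
    by (auto simp: finite_index_def)
  have Lsub: "L \<subseteq> carrier G" using L by (rule subgroup.subset)
  have fixC: "inv n <# C = C" if n: "n \<in> N" for n
  proof -
    obtain k where k: "k \<in> L" "n = g \<otimes> k \<otimes> inv g"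
      using n by (auto simp: N_def r_coset_def l_coset_def)
    have kG: "k \<in> carrier G" using k Lsub by auto
    have "n <# C = (g \<otimes> k) <# L"
      using k kG g by (simp add: lcos_translate m_assoc)
    also have "\<dots> = g <# L"
      using kG k g L by (subst lcos_eq_iff) (auto simp: inv_mult_group m_assoc subgroup.m_inv_closed)
    finally have "n <# C = C" using g by simp
    moreover have "n \<in> carrier G" using k kG g by simp
    ultimately show ?thesis using lcos_translate_inv_eq C by simp
  qed
  have "(\<lambda>l. inv l <# C) ` L \<subseteq> (\<lambda>K. inv (SOME l. l \<in> K) <# C) ` (rcosets\<^bsub>restrict_group G L\<^esub> N)"
  proof (rule image_subsetI)
    fix l assume l: "l \<in> L"
    define l' where "l' = (SOME l'. l' \<in> N #> l)"
    have "\<one> \<otimes> l \<in> N #> l"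
      using subgroup.one_closed[OF N] by (auto simp: r_coset_def)
    then have "l' \<in> N #> l" unfolding l'_def by (rule someI)
    then obtain n where n: "n \<in> N" "l' = n \<otimes> l" by (auto simp: r_coset_def)
    have G: "n \<in> carrier G" "l \<in> carrier G" using n l Lsub by (auto simp: N_def)
    have "inv l' <# C = inv l <# (inv n <# C)"
      using n G C by (simp add: inv_mult_group lcos_translate_mult)
    then have "inv l <# C = inv l' <# C" using fixC n by simp
    moreover have "N #> l \<in> rcosets\<^bsub>restrict_group G L\<^esub> N"
      using l by (auto simp: RCOSETS_def)
    ultimately show "inv l <# C \<in> (\<lambda>K. inv (SOME l. l \<in> K) <# C) ` (rcosets\<^bsub>restrict_group G L\<^esub> N)"
      unfolding l'_def by (rule image_eqI)
  qed
  then show ?thesis using fin finite_surj by blast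
qed

text \<open>A right coset of the stabilizer is determined by how the inverses of its elements move the cosets in
  \<open>F\<close>, and each of these has finitely many translates.\<close>

lemma finite_index_stabilizer_of_cosets:
  assumes comm: "commensurated G L" and F: "finite F" "F \<subseteq> lcosets L"
  shows "finite_index (restrict_group G L) {l \<in> L. \<forall>C\<in>F. l <# C = C}"
proof -
  define H where "H = {l \<in> L. \<forall>C\<in>F. l <# C = C}"
  have Lsub: "L \<subseteq> carrier G" using L by (rule subgroup.subset)
  have sub: "subgroup H G"
  proof (rule subgroupI)
    show "H \<subseteq> carrier G" using Lsub by (auto simp: H_def)
    show "H \<noteq> {}" using subgroup.one_closed[OF L] lcos_translate_one F(2) by (auto simp: H_def)
  next
    fix a assume "a \<in> H"
    then show "inv a \<in> H"
      using F(2) Lsub by (auto simp: H_def subgroup.m_inv_closed[OF L] lcos_translate_inv_eq subset_iff)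
  next
    fix a b assume "a \<in> H" "b \<in> H"
    then have ab: "a \<in> L" "b \<in> L" "a \<in> carrier G" "b \<in> carrier G"
      "\<And>C. C \<in> F \<Longrightarrow> a <# C = C" "\<And>C. C \<in> F \<Longrightarrow> b <# C = C"
      using Lsub by (auto simp: H_def)
    have "(a \<otimes> b) <# C = C" if "C \<in> F" for C
      using ab that F(2) lcos_translate_mult[of a b C] by auto
    then show "a \<otimes> b \<in> H"
      using ab by (auto simp: H_def subgroup.m_closed[OF L])
  qed
  have "rcosets\<^bsub>restrict_group G L\<^esub> H \<subseteq>
      (\<lambda>\<alpha>. {l \<in> L. \<forall>C\<in>F. inv l <# C = \<alpha> C}) ` (Pi\<^sub>E F (\<lambda>C. (\<lambda>l. inv l <# C) ` L))"
  proof
    fix K assume "K \<in> rcosets\<^bsub>restrict_group G L\<^esub> H"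
    then obtain m where m: "m \<in> L" "K = H #> m" by (auto simp: RCOSETS_def)
    have mG: "m \<in> carrier G" using m Lsub by auto
    have "K = {l \<in> L. \<forall>C\<in>F. inv l <# C = (\<lambda>C\<in>F. inv m <# C) C}"
    proof (intro Set.set_eqI iffI)
      fix l assume "l \<in> K"
      then obtain h where h: "h \<in> H" "l = h \<otimes> m" using m by (auto simp: r_coset_def)
      then have hG: "h \<in> carrier G" "h \<in> L" "\<And>C. C \<in> F \<Longrightarrow> h <# C = C" using Lsub by (auto simp: H_def)
      have "inv l <# C = inv m <# C" if "C \<in> F" for C
      proof -
        have C: "C \<in> lcosets L" using that F(2) by auto
        have "inv h <# C = C" using hG(3)[OF that] lcos_translate_inv_eq[OF hG(1) C C] by simp
        then show ?thesis
          using h(2) hG(1) mG C lcos_translate_mult[of "inv m" "inv h" C] by (simp add: inv_mult_group)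
      qed
      moreover have "l \<in> L" using h hG m by (simp add: subgroup.m_closed[OF L])
      ultimately show "l \<in> {l \<in> L. \<forall>C\<in>F. inv l <# C = (\<lambda>C\<in>F. inv m <# C) C}" by simp
    next
      fix l assume "l \<in> {l \<in> L. \<forall>C\<in>F. inv l <# C = (\<lambda>C\<in>F. inv m <# C) C}"
      then have l: "l \<in> L" "l \<in> carrier G" "\<And>C. C \<in> F \<Longrightarrow> inv l <# C = inv m <# C"
        using Lsub by auto
      have "(l \<otimes> inv m) <# C = C" if "C \<in> F" for C
      proof -
        have C: "C \<in> lcosets L" using that F(2) by auto
        have "(l \<otimes> inv m) <# C = l <# (inv l <# C)"
          using l(2) l(3)[OF that] mG C lcos_translate_mult[of l "inv m" C] by simp
        also have "\<dots> = C" using l(2) C by (simp add: lcos_translate_mult lcos_translate_one)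
        finally show ?thesis .
      qed
      then have "l \<otimes> inv m \<in> H"
        using l(1) m by (auto simp: H_def subgroup.m_closed[OF L] subgroup.m_inv_closed[OF L])
      moreover have "l = (l \<otimes> inv m) \<otimes> m" using l mG by (simp add: m_assoc)
      ultimately show "l \<in> K" unfolding m(2) r_coset_def by blast
    qed
    moreover have "(\<lambda>C\<in>F. inv m <# C) \<in> Pi\<^sub>E F (\<lambda>C. (\<lambda>l. inv l <# C) ` L)"
      using m by auto
    ultimately show "K \<in> (\<lambda>\<alpha>. {l \<in> L. \<forall>C\<in>F. inv l <# C = \<alpha> C}) `
        (Pi\<^sub>E F (\<lambda>C. (\<lambda>l. inv l <# C) ` L))"
      by (rule image_eqI)
  qed
  moreover have "finite (Pi\<^sub>E F (\<lambda>C. (\<lambda>l. inv l <# C) ` L))"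
    using F finite_translates_of_commensurated[OF comm] by (intro finite_PiE) auto
  ultimately have "finite (rcosets\<^bsub>restrict_group G L\<^esub> H)"
    by (rule finite_surj[rotated])
  moreover have "subgroup H (restrict_group G L)"
    using sub L by (intro subgroup_incl) (auto simp: H_def)
  ultimately show ?thesis by (simp add: finite_index_def H_def)
qed

end

end


section \<open>Orbit relations of countable groups\<close>

text \<open>A countable base of the topology separates points; this makes equality of measurable maps a measurable
  condition.\<close>

lemma standard_prob_space_separating:
  assumes "standard_prob_space M"
  obtains B where "countable B" "B \<subseteq> sets M"
    "\<And>x y. x \<in> space M \<Longrightarrow> y \<in> space M \<Longrightarrow> x \<noteq> y \<Longrightarrow> \<exists>U\<in>B. x \<in> U \<and> y \<notin> U"
proof -
  from assms obtain T where T: "completely_metrizable_space T" "second_countable T"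
    "space M = topspace T" "sets M = sets (borel_of_topology T)"
    by (auto simp: standard_prob_space_def)
  obtain B where B: "countable B" "\<And>V. V \<in> B \<Longrightarrow> openin T V"
    "\<And>U x. openin T U \<Longrightarrow> x \<in> U \<Longrightarrow> \<exists>V\<in>B. x \<in> V \<and> V \<subseteq> U"
    using T(2) unfolding second_countable_def by metis
  have sub: "{U. openin T U} \<subseteq> Pow (topspace T)" by (auto dest: openin_subset)
  have "B \<subseteq> sets M"
    using B(2) sub by (auto simp: T(4) borel_of_topology_def)
  moreover have "\<exists>U\<in>B. x \<in> U \<and> y \<notin> U" if xy: "x \<in> space M" "y \<in> space M" "x \<noteq> y" for x y
  proof -
    have "Hausdorff_space T"
      using T(1) completely_metrizable_imp_metrizable_space metrizable_imp_Hausdorff_space by blast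
    then obtain U V where "openin T U" "openin T V" "x \<in> U" "y \<in> V" "disjnt U V"
      using xy T(3) unfolding Hausdorff_space_def by metis
    then show ?thesis using B(3)[of U x] by (auto simp: disjnt_def)
  qed
  ultimately show ?thesis by (rule that[OF B(1)])
qed

lemma standard_prob_space_equalizer:
  assumes "standard_prob_space M" and [measurable]: "f \<in> measurable N M" "g \<in> measurable N M"
  shows "{x \<in> space N. f x = g x} \<in> sets N"
proof -
  obtain B where B: "countable B" "B \<subseteq> sets M"
    "\<And>x y. x \<in> space M \<Longrightarrow> y \<in> space M \<Longrightarrow> x \<noteq> y \<Longrightarrow> \<exists>U\<in>B. x \<in> U \<and> y \<notin> U"
    using standard_prob_space_separating[OF assms(1)] by blast
  have sp: "f x \<in> space M" "g x \<in> space M" if "x \<in> space N" for x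
    using that measurable_space[OF assms(2)] measurable_space[OF assms(3)] by auto
  have "{x \<in> space N. f x = g x} = space N - (\<Union>U\<in>B. (f -` U \<inter> space N) - (g -` U \<inter> space N))"
    using B(3)[OF sp] by auto
  moreover have "(\<Union>U\<in>B. (f -` U \<inter> space N) - (g -` U \<inter> space N)) \<in> sets N"
    using B(1,2) measurable_sets[OF assms(2)] measurable_sets[OF assms(3)]
    by (intro sets.countable_UN'') auto
  ultimately show ?thesis by auto
qed

locale pmp_action_of_countable_group = group G for G (structure) +
  fixes M :: "'x measure" and \<phi> :: "'a \<Rightarrow> 'x \<Rightarrow> 'x"
  assumes countable_group: "countable (carrier G)"
    and standard: "standard_prob_space M"
    and pmp: "pmp_action M G \<phi>"
begin

sublocale prob_space M
  using standard by (simp add: standard_prob_space_def)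

sublocale act: group_action G "space M" \<phi>
  using pmp by (simp add: pmp_action_def)

lemma act_space: "g \<in> carrier G \<Longrightarrow> x \<in> space M \<Longrightarrow> \<phi> g x \<in> space M"
  using act.element_image by blast

lemma act_one: "x \<in> space M \<Longrightarrow> \<phi> \<one> x = x"
  using act.id_eq_one by (metis restrict_apply')

lemma act_mult: "g \<in> carrier G \<Longrightarrow> h \<in> carrier G \<Longrightarrow> x \<in> space M \<Longrightarrow> \<phi> (g \<otimes> h) x = \<phi> g (\<phi> h x)"
  using act.composition_rule by blast

lemma act_inv: "g \<in> carrier G \<Longrightarrow> x \<in> space M \<Longrightarrow> \<phi> (inv g) (\<phi> g x) = x"
  using act.orbit_sym_aux by blast

lemma act_inv': "g \<in> carrier G \<Longrightarrow> x \<in> space M \<Longrightarrow> \<phi> g (\<phi> (inv g) x) = x"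
  using act_inv[of "inv g"] by simp

lemma measurable_act: "g \<in> carrier G \<Longrightarrow> \<phi> g \<in> measurable M M"
  using pmp by (simp add: pmp_action_def)

lemma distr_act: "g \<in> carrier G \<Longrightarrow> distr M M (\<phi> g) = M"
  using pmp by (simp add: pmp_action_def)

lemma emeasure_act:
  assumes "g \<in> carrier G" "A \<in> sets M"
  shows "emeasure M (\<phi> g -` A \<inter> space M) = emeasure M A"
  using emeasure_distr[OF measurable_act[OF assms(1)] assms(2)] distr_act[OF assms(1)] by simp

lemma AE_act:
  assumes "AE x in M. P x"
  shows "AE x in M. \<forall>g\<in>carrier G. P (\<phi> g x)"
proof -
  have "AE x in M. P (\<phi> g x)" if "g \<in> carrier G" for g
    by (rule AE_distrD[OF measurable_act[OF that]]) (simp only: distr_act[OF that] assms)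
  then show ?thesis using countable_group by (simp add: AE_ball_countable)
qed

lemma orbit_relation_iff:
  "(x, y) \<in> orbit_relation M G \<phi> \<longleftrightarrow> x \<in> space M \<and> (\<exists>g\<in>carrier G. y = \<phi> g x)"
  by (auto simp: orbit_relation_def orbit_def)

lemma AE_orbit_relation:
  assumes "AE x in M. P x"
  shows "AE x in M. \<forall>y. (x, y) \<in> orbit_relation M G \<phi> \<longrightarrow> P y"
  using AE_act[OF assms] by eventually_elim (auto simp: orbit_relation_iff)

lemma graph_act_sets:
  assumes "g \<in> carrier G"
  shows "{p \<in> space (M \<Otimes>\<^sub>M M). snd p = \<phi> g (fst p)} \<in> sets (M \<Otimes>\<^sub>M M)"
  using measurable_compose[OF measurable_fst measurable_act[OF assms]]
  by (intro standard_prob_space_equalizer[OF standard]) auto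

lemma orbit_relation_sets: "orbit_relation M G \<phi> \<in> sets (M \<Otimes>\<^sub>M M)"
proof -
  have "orbit_relation M G \<phi> = (\<Union>g\<in>carrier G. {p \<in> space (M \<Otimes>\<^sub>M M). snd p = \<phi> g (fst p)})"
    by (auto simp: orbit_relation_iff space_pair_measure act_space)
  then show ?thesis
    using graph_act_sets countable_group by (auto intro!: sets.countable_UN'')
qed

lemma equiv_orbit_relation: "equiv (space M) (orbit_relation M G \<phi>)"
proof (rule equivI)
  show "orbit_relation M G \<phi> \<subseteq> space M \<times> space M"
    by (auto simp: orbit_relation_iff act_space)
  show "refl_on (space M) (orbit_relation M G \<phi>)"
    using act_one[symmetric] by (auto simp: refl_on_def orbit_relation_iff act_space intro!: bexI[of _ \<one>])
  show "sym (orbit_relation M G \<phi>)"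
    using act_inv[symmetric] inv_closed by (auto simp: sym_def orbit_relation_iff act_space)
  show "trans (orbit_relation M G \<phi>)"
    using act_mult[symmetric] m_closed by (fastforce simp: trans_def orbit_relation_iff)
qed

text \<open>A full group element is pieced together from countably many group elements: the space is partitioned
  into measurable sets \<open>D n\<close> on which it equals the action of \<open>e n\<close>, and injectivity makes the images
  \<open>f ` D n\<close> disjoint as well.\<close>

lemma full_group_preserves_measure:
  assumes f: "f \<in> full_group M (orbit_relation M G \<phi>)"
  shows "distr M M f = M"
proof (rule measure_eqI)
  have bij: "bij_betw f (space M) (space M)" and [measurable]: "f \<in> measurable M M"
    and inv_meas: "the_inv_into (space M) f \<in> measurable M M"
    and R: "\<And>x. x \<in> space M \<Longrightarrow> \<exists>g\<in>carrier G. f x = \<phi> g x"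
    using f by (auto simp: full_group_def borel_automorphism_def orbit_relation_iff)
  define e where "e = from_nat_into (carrier G)"
  have e: "e n \<in> carrier G" for n
    unfolding e_def by (rule from_nat_into) auto
  have e_surj: "\<exists>n. g = e n" if "g \<in> carrier G" for g
    unfolding e_def using from_nat_into_surj[OF countable_group that] by metis
  define E where "E = (\<lambda>n. {x \<in> space M. f x = \<phi> (e n) x})"
  have E: "E n \<in> sets M" for n
    unfolding E_def
    by (intro standard_prob_space_equalizer[OF standard] measurable_act e) measurable
  define D where "D = disjointed E"
  have D: "D n \<in> sets M" "D n \<subseteq> E n" "D n \<subseteq> space M" for n
    using sets.range_disjointed_sets[of E M] E disjointed_subset[of E n] sets.sets_into_space[OF E[of n]]
    by (auto simp: D_def)
  have D_disj: "disjoint_family D" by (simp add: D_def disjoint_family_disjointed)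
  have D_UN: "(\<Union>n. D n) = space M"
  proof -
    have "x \<in> (\<Union>n. E n)" if x: "x \<in> space M" for x
    proof -
      obtain g where "g \<in> carrier G" "f x = \<phi> g x" using R[OF x] by auto
      moreover from this obtain n where "g = e n" using e_surj by auto
      ultimately show ?thesis using x by (auto simp: E_def)
    qed
    then have "(\<Union>n. E n) = space M" by (auto simp: E_def)
    then show ?thesis by (simp add: D_def UN_disjointed_eq)
  qed
  have f_inv: "the_inv_into (space M) f (f x) = x" if "x \<in> space M" for x
    using bij that by (auto simp: bij_betw_def the_inv_into_f_f)
  have f_space: "f x \<in> space M" if "x \<in> space M" for x
    using bij that by (auto simp: bij_betw_def)
  have fD: "f ` D n \<in> sets M" for n
  proof -
    have "f ` D n = the_inv_into (space M) f -` D n \<inter> space M"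
    proof (intro Set.set_eqI iffI)
      fix y assume "y \<in> f ` D n"
      then show "y \<in> the_inv_into (space M) f -` D n \<inter> space M"
        using D(3)[of n] f_inv f_space by auto
    next
      fix y assume y: "y \<in> the_inv_into (space M) f -` D n \<inter> space M"
      then have "f (the_inv_into (space M) f y) = y"
        using bij by (intro f_the_inv_into_f_bij_betw) auto
      then show "y \<in> f ` D n" using y by (metis IntD1 image_eqI vimageE)
    qed
    then show ?thesis using measurable_sets[OF inv_meas D(1)] by simp
  qed
  fix B assume "B \<in> sets (distr M M f)"
  then have B: "B \<in> sets M" by simp
  have B_space: "B \<subseteq> space M" using sets.sets_into_space[OF B] .
  have eq: "f -` B \<inter> D n = \<phi> (e n) -` (B \<inter> f ` D n) \<inter> space M" for n
  proof (intro Set.set_eqI iffI)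
    fix x assume "x \<in> f -` B \<inter> D n"
    then have x: "f x \<in> B" "x \<in> D n" by auto
    then have "f x = \<phi> (e n) x" "x \<in> space M" using D(2)[of n] by (auto simp: E_def)
    then show "x \<in> \<phi> (e n) -` (B \<inter> f ` D n) \<inter> space M"
      using x by (metis IntI imageI vimageI)
  next
    fix x assume x: "x \<in> \<phi> (e n) -` (B \<inter> f ` D n) \<inter> space M"
    then obtain y where y: "y \<in> D n" "\<phi> (e n) x = f y" by auto
    then have "\<phi> (e n) x = \<phi> (e n) y" "y \<in> space M" using D(2)[of n] by (auto simp: E_def)
    then have "x = y" using act.inj_prop[OF e] x by (auto simp: inj_on_def)
    then show "x \<in> f -` B \<inter> D n" using x y by auto
  qed
  have "emeasure (distr M M f) B = emeasure M (f -` B \<inter> space M)"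
    using B by (simp add: emeasure_distr)
  also have "f -` B \<inter> space M = (\<Union>n. f -` B \<inter> D n)"
    using D_UN by blast
  also have "emeasure M \<dots> = (\<Sum>n. emeasure M (f -` B \<inter> D n))"
  proof (rule suminf_emeasure[symmetric])
    show "range (\<lambda>n. f -` B \<inter> D n) \<subseteq> sets M"
      unfolding eq using measurable_sets[OF measurable_act[OF e] sets.Int[OF B fD]] by blast
    show "disjoint_family (\<lambda>n. f -` B \<inter> D n)"
      using D_disj by (auto simp: disjoint_family_on_def)
  qed
  also have "\<dots> = (\<Sum>n. emeasure M (B \<inter> f ` D n))"
    unfolding eq by (intro suminf_cong emeasure_act[OF e] sets.Int B fD)
  also have "\<dots> = emeasure M (\<Union>n. B \<inter> f ` D n)"
  proof (rule suminf_emeasure)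
    show "range (\<lambda>n. B \<inter> f ` D n) \<subseteq> sets M" using B fD by auto
    have "f ` D m \<inter> f ` D n = {}" if "m \<noteq> n" for m n
    proof -
      have "f ` D m \<inter> f ` D n = f ` (D m \<inter> D n)"
        using bij D(3) by (intro inj_on_image_Int[symmetric, of _ "space M"]) (auto simp: bij_betw_def)
      then show ?thesis using D_disj that by (auto simp: disjoint_family_on_def)
    qed
    then show "disjoint_family (\<lambda>n. B \<inter> f ` D n)"
      unfolding disjoint_family_on_def by blast
  qed
  also have "(\<Union>n. B \<inter> f ` D n) = B \<inter> f ` (\<Union>n. D n)" by blast
  also have "\<dots> = B" using bij B_space by (simp add: D_UN bij_betw_def Int_absorb2)
  finally show "emeasure (distr M M f) B = emeasure M B" .
qed simp

lemma pmp_equiv_rel_orbit_relation: "pmp_equiv_rel M (orbit_relation M G \<phi>)"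
proof -
  have "countable (orbit_relation M G \<phi> `` {x})" for x
  proof (rule countable_subset)
    show "orbit_relation M G \<phi> `` {x} \<subseteq> (\<lambda>g. \<phi> g x) ` carrier G"
      by (auto simp: orbit_relation_iff)
  qed (use countable_group in auto)
  then show ?thesis
    unfolding pmp_equiv_rel_def
    using standard equiv_orbit_relation orbit_relation_sets full_group_preserves_measure by blast
qed

lemma act_in_full_group:
  assumes "g \<in> carrier G"
  shows "\<phi> g \<in> full_group M (orbit_relation M G \<phi>)"
proof -
  have bij: "bij_betw (\<phi> g) (space M) (space M)"
    using act.bij_prop0[OF assms] by (simp add: Bij_def)
  have "the_inv_into (space M) (\<phi> g) x = \<phi> (inv g) x" if "x \<in> space M" for x
    using that assms bij act_inv' by (intro the_inv_into_f_eq) (auto simp: bij_betw_def act_space)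
  then have "the_inv_into (space M) (\<phi> g) \<in> measurable M M"
    using measurable_act[OF inv_closed[OF assms]] by (subst measurable_cong) auto
  then show ?thesis
    using assms bij measurable_act by (auto simp: full_group_def borel_automorphism_def orbit_relation_iff)
qed

text \<open>Invariance only matters up to null sets, and the action carries null sets to null sets.\<close>

lemma trivial_invariant_sets:
  assumes "A \<in> sets M" "measure M A = 0 \<or> measure M A = 1"
  shows "A \<in> invariant_sets M (orbit_relation M G \<phi>)"
proof -
  have "(AE x in M. x \<notin> A) \<or> (AE x in M. x \<in> A)"
    using assms by (auto simp: prob_eq_0 prob_eq_1)
  then have "AE x in M. \<forall>y. (x, y) \<in> orbit_relation M G \<phi> \<longrightarrow> (x \<in> A \<longleftrightarrow> y \<in> A)"
  proof
    assume "AE x in M. x \<notin> A"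
    from this AE_orbit_relation[OF this] show ?thesis by eventually_elim auto
  next
    assume "AE x in M. x \<in> A"
    from this AE_orbit_relation[OF this] show ?thesis by eventually_elim auto
  qed
  then show ?thesis using assms by (simp add: invariant_sets_def)
qed

lemma ergodic_orbit_relation:
  assumes "ergodic_action M G \<phi>"
  shows "ergodic_rel M (orbit_relation M G \<phi>)"
  unfolding ergodic_rel_def
proof
  fix A assume "A \<in> invariant_sets M (orbit_relation M G \<phi>)"
  then have A: "A \<in> sets M" "AE x in M. \<forall>y. (x, y) \<in> orbit_relation M G \<phi> \<longrightarrow> (x \<in> A \<longleftrightarrow> y \<in> A)"
    by (auto simp: invariant_sets_def)
  have "AE x in M. \<phi> g x \<in> A \<longleftrightarrow> x \<in> A" if "g \<in> carrier G" for g
    using A(2) AE_space by eventually_elim (use that in \<open>auto simp: orbit_relation_iff\<close>)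
  then show "measure M A = 0 \<or> measure M A = 1"
    using assms A(1) by (simp add: ergodic_action_def)
qed

lemma subgroup_action:
  assumes "subgroup H G"
  shows "pmp_action_of_countable_group (restrict_group G H) M \<phi>"
proof -
  have "group_action (restrict_group G H) (space M) \<phi>"
    using subgroup.subgroup_is_group[OF assms is_group] act.group_hom subgroup.subset[OF assms]
    by (auto simp: group_action_def group_hom_def group_hom_axioms_def hom_def)
  then show ?thesis
    using subgroup.subgroup_is_group[OF assms is_group] subgroup.subset[OF assms]
      countable_subset[OF _ countable_group] standard pmp
    by (auto simp: pmp_action_of_countable_group_def pmp_action_of_countable_group_axioms_def pmp_action_def)
qed

text \<open>The union of all translates of \<open>B\<close> under \<open>H\<close> is invariant and not null, hence conull, so it meets \<open>A\<close>;
  as \<open>H\<close> is countable, one of the translates meets \<open>A\<close> in a set of positive measure.\<close>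

lemma ergodic_subgroup_overlap:
  assumes H: "subgroup H G" and erg: "ergodic_action M (restrict_group G H) \<phi>"
    and A: "A \<in> sets M" "emeasure M A \<noteq> 0" and B: "B \<in> sets M" "emeasure M B \<noteq> 0"
  shows "\<exists>s\<in>H. emeasure M {x \<in> A. \<phi> s x \<in> B} \<noteq> 0"
proof -
  have HG: "H \<subseteq> carrier G" using H by (rule subgroup.subset)
  have H_countable: "countable H" using HG countable_group by (rule countable_subset)
  define U where "U = {x \<in> space M. \<exists>s\<in>H. \<phi> s x \<in> B}"
  have U_eq: "U = (\<Union>s\<in>H. \<phi> s -` B \<inter> space M)" by (auto simp: U_def)
  have U: "U \<in> sets M"
    unfolding U_eq using HG B
    by (intro sets.countable_UN'' H_countable measurable_sets[OF measurable_act]) auto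
  have "\<phi> g x \<in> U \<longleftrightarrow> x \<in> U" if g: "g \<in> H" and x: "x \<in> space M" for g x
  proof
    assume "\<phi> g x \<in> U"
    then obtain s where s: "s \<in> H" "\<phi> s (\<phi> g x) \<in> B" by (auto simp: U_def)
    then have "\<phi> (s \<otimes> g) x \<in> B" using HG g x by (subst act_mult) auto
    then show "x \<in> U" using s g x subgroup.m_closed[OF H] by (auto simp: U_def)
  next
    assume "x \<in> U"
    then obtain s where s: "s \<in> H" "\<phi> s x \<in> B" by (auto simp: U_def)
    have G: "s \<in> carrier G" "g \<in> carrier G" using s g HG by auto
    have "\<phi> (s \<otimes> inv g) (\<phi> g x) = \<phi> s x"
      using G x by (simp add: act_mult act_inv act_space)
    then show "\<phi> g x \<in> U"
      using s g x G subgroup.m_closed[OF H] subgroup.m_inv_closed[OF H] act_space by (force simp: U_def)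
  qed
  then have "\<forall>g\<in>H. AE x in M. \<phi> g x \<in> U \<longleftrightarrow> x \<in> U" by (intro ballI AE_I2)
  then have "measure M U = 0 \<or> measure M U = 1"
    using erg U by (simp add: ergodic_action_def)
  moreover have "B \<subseteq> U"
    using sets.sets_into_space[OF B(1)] subgroup.one_closed[OF H] act_one by (force simp: U_def)
  then have "emeasure M U \<noteq> 0" using emeasure_mono[OF _ U] B(2) by (metis le_zero_eq)
  ultimately have "AE x in M. x \<in> U"
    using U by (simp add: prob_eq_1 emeasure_eq_measure)
  show ?thesis
  proof (rule ccontr)
    assume "\<not> ?thesis"
    then have null: "emeasure M {x \<in> A. \<phi> s x \<in> B} = 0" if "s \<in> H" for s using that by auto
    have meas: "{x \<in> A. \<phi> s x \<in> B} \<in> sets M" if "s \<in> H" for s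
    proof -
      have "{x \<in> A. \<phi> s x \<in> B} = A \<inter> (\<phi> s -` B \<inter> space M)"
        using sets.sets_into_space[OF A(1)] by auto
      then show ?thesis using A(1) measurable_sets[OF measurable_act B(1)] that HG by auto
    qed
    have "AE x in M. x \<notin> {x \<in> A. \<phi> s x \<in> B}" if "s \<in> H" for s
      using null[OF that] meas[OF that] by (intro AE_not_in) auto
    then have "AE x in M. \<forall>s\<in>H. x \<notin> {x \<in> A. \<phi> s x \<in> B}"
      by (intro AE_ball_countable[THEN iffD2, OF H_countable] ballI)
    with \<open>AE x in M. x \<in> U\<close> have "AE x in M. x \<notin> A"
      by eventually_elim (auto simp: U_def)
    then show False using A by (simp add: AE_iff_null_sets[symmetric] null_sets_def)
  qed
qed

end


section \<open>Existence of an ergodic index cocycle\<close>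

lemma space_borel_of_topology [simp]: "space (borel_of_topology T) = topspace T"
  by (simp add: borel_of_topology_def space_measure_of_conv)

locale free_aperiodic_action = pmp_action_of_countable_group G M \<phi>
  for G :: "('g, 'b) monoid_scheme" (structure) and M :: "'x measure" and \<phi> +
  fixes L :: "'g set"
  assumes comm: "commensurated G L"
    and free: "free_action M G \<phi>"
    and aperiodic: "aperiodic_action M (restrict_group G L) \<phi>"
begin

abbreviation (input) R where "R \<equiv> orbit_relation M G \<phi>"
abbreviation (input) S where "S \<equiv> orbit_relation M (restrict_group G L) \<phi>"
abbreviation (input) J where "J \<equiv> lcosets L"

lemma L_subgroup: "subgroup L G"
  using comm by (simp add: commensurated_def)

lemma L_sub: "L \<subseteq> carrier G"
  using L_subgroup by (rule subgroup.subset)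

lemma S_action: "pmp_action_of_countable_group (restrict_group G L) M \<phi>"
  using L_subgroup by (rule subgroup_action)

lemma S_iff: "(x, y) \<in> S \<longleftrightarrow> x \<in> space M \<and> (\<exists>l\<in>L. y = \<phi> l x)"
  using pmp_action_of_countable_group.orbit_relation_iff[OF S_action] by simp

lemma S_subset_R: "S \<subseteq> R"
proof (rule subrelI)
  fix x y assume "(x, y) \<in> S"
  then show "(x, y) \<in> R" using L_sub unfolding S_iff orbit_relation_iff by blast
qed

lemma equiv_S: "equiv (space M) S"
  by (rule pmp_action_of_countable_group.equiv_orbit_relation[OF S_action])

lemma ergodic_finite_index:
  assumes "finite_index (restrict_group G L) H"
  shows "ergodic_action M (restrict_group G H) \<phi>"
  using aperiodic assms by (auto simp: aperiodic_action_def)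

lemma finite_index_L: "finite_index (restrict_group G L) L"
  using finite_index_stabilizer_of_cosets[OF L_subgroup comm, of "{}"] by simp

lemma ergodic_rel_S: "ergodic_rel M S"
  by (rule pmp_action_of_countable_group.ergodic_orbit_relation[OF S_action])
     (rule ergodic_finite_index[OF finite_index_L])

lemma ergodic_rel_R: "ergodic_rel M R"
proof -
  have "invariant_sets M R \<subseteq> invariant_sets M S"
    using S_subset_R by (auto simp: invariant_sets_def elim!: eventually_mono)
  then show ?thesis using ergodic_rel_S by (auto simp: ergodic_rel_def)
qed

definition free_point :: "'x \<Rightarrow> bool" where
  "free_point x \<longleftrightarrow> x \<in> space M \<and> (\<forall>g\<in>carrier G. \<phi> g x = x \<longrightarrow> g = \<one>)"

lemma AE_free_point: "AE x in M. free_point x"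
proof -
  have "AE x in M. stabilizer G \<phi> x = {\<one>}" using free by (simp add: free_action_def)
  with AE_space show ?thesis
    by eventually_elim (auto simp: free_point_def stabilizer_def)
qed

lemma free_point_space: "free_point x \<Longrightarrow> x \<in> space M"
  by (simp add: free_point_def)

lemma free_point_inj:
  assumes "free_point x" "g \<in> carrier G" "h \<in> carrier G" "\<phi> g x = \<phi> h x"
  shows "g = h"
proof -
  have x: "x \<in> space M" using assms(1) by (simp add: free_point_def)
  have "\<phi> (inv h \<otimes> g) x = x"
    using assms x by (simp add: act_mult act_inv)
  then have "inv h \<otimes> g = \<one>" using assms by (simp add: free_point_def)
  then show ?thesis using assms by (metis inv_closed inv_equality inv_inv)
qed

lemma free_point_act:
  assumes x: "free_point x" and g: "g \<in> carrier G"
  shows "free_point (\<phi> g x)"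
proof -
  have xs: "x \<in> space M" using x by (simp add: free_point_def)
  have "h = \<one>" if h: "h \<in> carrier G" "\<phi> h (\<phi> g x) = \<phi> g x" for h
  proof -
    have "\<phi> (h \<otimes> g) x = \<phi> g x" using h g xs by (simp add: act_mult)
    then have "h \<otimes> g = g" using free_point_inj[OF x] h g by simp
    then show ?thesis using h g by simp
  qed
  then show ?thesis using act_space g xs by (simp add: free_point_def)
qed

text \<open>Freeness turns classes into cosets: \<open>\<phi> g x\<close> and \<open>\<phi> h x\<close> lie in one \<open>L\<close>-orbit iff \<open>L g = L h\<close>. Inverting
  converts right cosets into the left cosets on which the completion acts.\<close>

lemma S_class_eq_iff:
  assumes x: "free_point x" and g: "g \<in> carrier G" and h: "h \<in> carrier G"
  shows "S `` {\<phi> g x} = S `` {\<phi> h x} \<longleftrightarrow> inv g <# L = inv h <# L"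
proof -
  have xs: "x \<in> space M" using x by (rule free_point_space)
  have "S `` {\<phi> g x} = S `` {\<phi> h x} \<longleftrightarrow> (\<phi> h x, \<phi> g x) \<in> S"
    using eq_equiv_class_iff[OF equiv_S, of "\<phi> h x" "\<phi> g x"] act_space g h xs by auto
  also have "\<dots> \<longleftrightarrow> (\<exists>l\<in>L. \<phi> g x = \<phi> (l \<otimes> h) x)"
    using g h xs L_sub act_space by (auto simp: S_iff act_mult subset_iff)
  also have "\<dots> \<longleftrightarrow> (\<exists>l\<in>L. g = l \<otimes> h)"
    using free_point_inj[OF x] g h L_sub by (metis m_closed subsetD)
  also have "\<dots> \<longleftrightarrow> g \<otimes> inv h \<in> L"
  proof
    assume "\<exists>l\<in>L. g = l \<otimes> h"
    then obtain l where l: "l \<in> L" "g = l \<otimes> h" by auto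
    then have "g \<otimes> inv h = l" using h L_sub by (auto simp: m_assoc subset_iff)
    then show "g \<otimes> inv h \<in> L" using l by simp
  next
    assume "g \<otimes> inv h \<in> L"
    then show "\<exists>l\<in>L. g = l \<otimes> h"
      using g h by (intro bexI[of _ "g \<otimes> inv h"]) (auto simp: m_assoc)
  qed
  also have "\<dots> \<longleftrightarrow> inv g <# L = inv h <# L"
    using g h by (simp add: lcos_eq_iff[OF L_subgroup])
  finally show ?thesis .
qed

text \<open>An open subgroup \<open>K\<close> contains the pointwise stabilizer of a finite set of indices. Hence \<open>\<Omega> (x, \<phi> h x)\<close>
  lies in \<open>K\<close> whenever \<open>h \<in> L\<close> fixes the corresponding finitely many cosets, and such \<open>h\<close> form a group that
  acts ergodically.\<close>

lemma invariant_sets_of_constant_conjugacy: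
  assumes bij: "bij_betw \<theta> I J"
    and \<Omega>: "\<And>p. p \<in> R \<Longrightarrow> \<Omega> p \<in> Bij I"
    and eq: "AE x in M. \<forall>h\<in>carrier G. \<forall>i\<in>I. \<theta> (\<Omega> (x, \<phi> h x) i) = inv h <# \<theta> i"
    and K: "subgroup K (BijGroup I)" "openin (Sym_topology I) K"
  shows "invariant_sets M {p \<in> R. \<Omega> p \<in> K} = invariant_sets M R"
proof
  show "invariant_sets M R \<subseteq> invariant_sets M {p \<in> R. \<Omega> p \<in> K}"
    by (auto simp: invariant_sets_def elim!: eventually_mono)
  show "invariant_sets M {p \<in> R. \<Omega> p \<in> K} \<subseteq> invariant_sets M R"
  proof
    fix A assume "A \<in> invariant_sets M {p \<in> R. \<Omega> p \<in> K}"
    then have A: "A \<in> sets M"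
      and inv: "AE x in M. \<forall>y. (x, y) \<in> {p \<in> R. \<Omega> p \<in> K} \<longrightarrow> (x \<in> A \<longleftrightarrow> y \<in> A)"
      by (auto simp: invariant_sets_def)
    have one: "(\<lambda>i\<in>I. i) \<in> K"
      using subgroup.one_closed[OF K(1)] by (simp add: BijGroup_def)
    obtain F where F: "finite F" "F \<subseteq> I"
      "\<forall>f\<in>Bij I. (\<forall>i\<in>F. f i = (\<lambda>i\<in>I. i) i) \<longrightarrow> f \<in> K"
      using bspec[OF conjunct2[OF openin_Sym_topology_iff[THEN iffD1, OF K(2)]] one] by (elim exE conjE)
    have FJ: "finite (\<theta> ` F)" "\<theta> ` F \<subseteq> J"
      using F bij by (auto simp: bij_betw_def)
    define H where "H = {l \<in> L. \<forall>C\<in>\<theta> ` F. l <# C = C}"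
    have H: "finite_index (restrict_group G L) H"
      unfolding H_def using finite_index_stabilizer_of_cosets[OF L_subgroup comm FJ] .
    have "AE x in M. \<phi> h x \<in> A \<longleftrightarrow> x \<in> A" if h: "h \<in> H" for h
      using inv eq AE_space
    proof eventually_elim
      case (elim x)
      have hG: "h \<in> carrier G" using h L_sub by (auto simp: H_def)
      have R: "(x, \<phi> h x) \<in> R" using elim(3) hG by (auto simp: orbit_relation_iff)
      have B: "\<Omega> (x, \<phi> h x) \<in> Bij I" using \<Omega>[OF R] .
      have "\<Omega> (x, \<phi> h x) i = i" if i: "i \<in> F" for i
      proof -
        have iI: "i \<in> I" "\<theta> i \<in> J" using i F(2) FJ by auto
        have "h <# \<theta> i = \<theta> i" using h i by (auto simp: H_def)
        then have "inv h <# \<theta> i = \<theta> i"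
          using lcos_translate_inv_eq[OF L_subgroup hG iI(2) iI(2)] by simp
        then have "\<theta> (\<Omega> (x, \<phi> h x) i) = \<theta> i" using elim(2) hG iI(1) by simp
        then show ?thesis
          using inj_onD[OF bij_betw_imp_inj_on[OF bij]] iI(1) Bij_apply[OF B iI(1)] by blast
      qed
      then have "\<forall>i\<in>F. \<Omega> (x, \<phi> h x) i = (\<lambda>i\<in>I. i) i"
        using F(2) by (simp add: subset_iff)
      then have "\<Omega> (x, \<phi> h x) \<in> K" using bspec[OF F(3) B] by (rule mp[rotated])
      then show ?case using elim(1) R by auto
    qed
    moreover have "ergodic_action M (restrict_group G H) \<phi>"
      using H by (rule ergodic_finite_index)
    ultimately have "measure M A = 0 \<or> measure M A = 1"
      using A by (simp add: ergodic_action_def)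
    then show "A \<in> invariant_sets M R"
      using A by (intro trivial_invariant_sets)
  qed
qed

text \<open>The index set consists of codes \<open>b C\<close> of left cosets \<open>C\<close>, with \<open>\<theta>\<close> the decoding, and \<open>c i\<close> acts by the
  inverse of a representative of \<open>\<theta> i\<close>. The value of \<open>\<Omega>\<close> at \<open>(x, \<phi> h x)\<close> is translation by \<open>inv h\<close>, read
  through \<open>b\<close>.\<close>

lemma aperiodic_inclusion_S_R: "aperiodic_inclusion M S R"
proof -
  have J_countable: "countable J"
    using countable_group by (simp add: LCOSETS_def)
  define b where "b = to_nat_on J"
  define I where "I = b ` J"
  define \<theta> where "\<theta> = inv_into J b"
  have bij_b: "bij_betw b J I"
    unfolding I_def b_def using J_countable by (simp add: bij_betw_def inj_on_to_nat_on)
  have bij: "bij_betw \<theta> I J"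
    unfolding \<theta>_def using bij_b by (rule bij_betw_inv_into)
  have \<theta>_J: "\<theta> i \<in> J" and b_\<theta>: "b (\<theta> i) = i" if "i \<in> I" for i
    using that bij_b unfolding \<theta>_def by (auto simp: bij_betw_def inv_into_into f_inv_into_f)
  have \<theta>_b: "\<theta> (b C) = C" and b_I: "b C \<in> I" if "C \<in> J" for C
    using that bij_b unfolding \<theta>_def by (auto simp: bij_betw_def inv_into_f_f)
  have LJ: "L \<in> J"
    using lcosetsI[OF one_closed, of L] L_sub by (simp add: lcos_mult_one)
  \<comment> \<open>the trivial coset is represented by \<open>\<one>\<close> because the family has to contain the identity map\<close>
  define r where "r = (\<lambda>C. if C = L then \<one> else SOME a. a \<in> carrier G \<and> C = a <# L)"
  have r: "r C \<in> carrier G \<and> C = r C <# L" if "C \<in> J" for C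
  proof (cases "C = L")
    case True then show ?thesis using L_sub by (simp add: r_def lcos_mult_one)
  next
    case False
    have "\<exists>a. a \<in> carrier G \<and> C = a <# L" using that by (auto simp: LCOSETS_def)
    from someI_ex[OF this] show ?thesis using False by (simp add: r_def)
  qed
  define c where "c = (\<lambda>i. \<phi> (inv (r (\<theta> i))))"
  have rG: "r (\<theta> i) \<in> carrier G" and rL: "r (\<theta> i) <# L = \<theta> i" if "i \<in> I" for i
    using r[OF \<theta>_J[OF that]] by auto
  have c_class: "S `` {c i x} = S `` {\<phi> g x} \<longleftrightarrow> \<theta> i = inv g <# L"
    if "free_point x" "i \<in> I" "g \<in> carrier G" for x i g
    using S_class_eq_iff[OF that(1), of "inv (r (\<theta> i))" g] rG[OF that(2)] rL[OF that(2)] that(3)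
    by (simp add: c_def)
  have family: "index_family M S R I c"
    unfolding index_family_def
  proof (intro conjI ballI)
    show "countable I" unfolding I_def using J_countable by simp
    show "c i \<in> full_group M R" if "i \<in> I" for i
      unfolding c_def using rG[OF that] by (intro act_in_full_group) simp
    show "\<exists>i\<in>I. AE x in M. c i x = x"
    proof (rule bexI[OF _ b_I[OF LJ]])
      show "AE x in M. c (b L) x = x"
        by (rule AE_I2) (simp add: c_def \<theta>_b[OF LJ] r_def act_one)
    qed
    show "AE x in M. R `` {x} = (\<Union>i\<in>I. S `` {c i x}) \<and> disjoint_family_on (\<lambda>i. S `` {c i x}) I"
      using AE_free_point
    proof eventually_elim
      case (elim x)
      have x: "x \<in> space M" using elim by (rule free_point_space)
      have c_space: "c i x \<in> space M" if "i \<in> I" for i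
        unfolding c_def using rG[OF that] x by (simp add: act_space)
      have "R `` {x} = (\<Union>i\<in>I. S `` {c i x})"
      proof (intro Set.set_eqI iffI)
        fix y assume "y \<in> R `` {x}"
        then obtain g where g: "g \<in> carrier G" "y = \<phi> g x" by (auto simp: orbit_relation_iff)
        define i where "i = b (inv g <# L)"
        have "inv g <# L \<in> J" using g lcosetsI by simp
        then have i: "i \<in> I" "\<theta> i = inv g <# L" using \<theta>_b b_I by (auto simp: i_def)
        then have "S `` {c i x} = S `` {y}" using c_class[OF elim i(1) g(1)] g by simp
        moreover have "y \<in> S `` {y}"
          using equiv_S g x by (auto simp: equiv_def refl_on_def act_space)
        ultimately show "y \<in> (\<Union>i\<in>I. S `` {c i x})" using i(1) by blast
      next
        fix y assume "y \<in> (\<Union>i\<in>I. S `` {c i x})"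
        then obtain i where i: "i \<in> I" "(c i x, y) \<in> R" using S_subset_R by blast
        moreover have "(x, c i x) \<in> R"
          unfolding c_def using rG[OF i(1)] x by (auto simp: orbit_relation_iff)
        ultimately show "y \<in> R `` {x}"
          using equiv_orbit_relation by (auto simp: equiv_def dest: transD)
      qed
      moreover have "disjoint_family_on (\<lambda>i. S `` {c i x}) I"
        unfolding disjoint_family_on_def
      proof (intro ballI impI, rule ccontr)
        fix i j assume ij: "i \<in> I" "j \<in> I" "i \<noteq> j" "S `` {c i x} \<inter> S `` {c j x} \<noteq> {}"
        then have "(c i x, c j x) \<in> S"
          using equiv_S by (meson IntE Image_singleton_iff equals0I equiv_def symE transE)
        then have "S `` {c i x} = S `` {c j x}"
          using equiv_class_eq[OF equiv_S] by blast
        then have "\<theta> i = \<theta> j"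
          using c_class[OF elim ij(1), of "inv (r (\<theta> j))"] rG[OF ij(2)] rL[OF ij(2)] by (simp add: c_def)
        then show False using ij b_\<theta> by metis
      qed
      ultimately show ?case by blast
    qed
  qed
  define e where "e = from_nat_into (carrier G)"
  have e: "e n \<in> carrier G" for n
    unfolding e_def by (rule from_nat_into) auto
  have e_surj: "\<exists>n. e n = g" if "g \<in> carrier G" for g
    unfolding e_def using from_nat_into_surj[OF countable_group that] by metis
  \<comment> \<open>At points with non-trivial stabilizer the group element carrying \<open>fst p\<close> to \<open>snd p\<close> is not unique;
    picking the first one in an enumeration keeps \<open>\<Omega>\<close> everywhere defined and measurable.\<close>
  define n where "n = (\<lambda>p. LEAST n. snd p = \<phi> (e n) (fst p))"
  define w where "w = (\<lambda>g. conj_bij J I b (left_mult_perm G L (inv g)))"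
  define \<Omega> where "\<Omega> = (\<lambda>p. w (e (n p)))"
  have w_Bij: "w g \<in> Bij I" if "g \<in> carrier G" for g
    unfolding w_def using that by (intro conj_bij_Bij[OF bij_b] left_mult_perm_Bij[OF L_subgroup]) simp
  have w_apply: "\<theta> (w g i) = inv g <# \<theta> i" if "g \<in> carrier G" "i \<in> I" for g i
  proof -
    have "w g i = b (left_mult_perm G L (inv g) (\<theta> i))"
      using conj_bij_theta[OF bij_b \<theta>_J[OF that(2)]] b_\<theta>[OF that(2)] by (simp add: w_def)
    then show ?thesis
      using that \<theta>_J by (simp add: left_mult_perm_def \<theta>_b lcos_translate_closed[OF L_subgroup])
  qed
  have \<Omega>_Bij: "\<Omega> p \<in> Bij I" for p
    unfolding \<Omega>_def using e w_Bij by blast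
  have \<Omega>_free: "\<Omega> (x, \<phi> h x) = w h" if "free_point x" "h \<in> carrier G" for x h
  proof -
    obtain m where "e m = h" using e_surj \<open>h \<in> carrier G\<close> by blast
    then have "snd (x, \<phi> h x) = \<phi> (e m) (fst (x, \<phi> h x))" by simp
    then have "snd (x, \<phi> h x) = \<phi> (e (n (x, \<phi> h x))) (fst (x, \<phi> h x))"
      unfolding n_def by (rule LeastI)
    then have "e (n (x, \<phi> h x)) = h"
      using free_point_inj[OF that(1) e that(2)] by simp
    then show ?thesis by (simp add: \<Omega>_def)
  qed
  have meas: "\<Omega> \<in> measurable (restrict_space (M \<Otimes>\<^sub>M M) R) (borel_of_topology (Sym_topology I))"
  proof -
    let ?N = "restrict_space (M \<Otimes>\<^sub>M M) R"
    have "{p \<in> space ?N. snd p = \<phi> (e k) (fst p)} \<in> sets ?N" for k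
      by (intro standard_prob_space_equalizer[OF standard] measurable_restrict_space1 measurable_snd
          measurable_compose[OF measurable_fst measurable_act[OF e]])
    then have "n \<in> measurable ?N (count_space UNIV)"
      unfolding n_def by (intro measurable_Least) (simp add: pred_def)
    moreover have "(\<lambda>k. w (e k)) \<in> measurable (count_space UNIV) (borel_of_topology (Sym_topology I))"
      using w_Bij e by (auto simp: measurable_count_space_eq1)
    ultimately show ?thesis unfolding \<Omega>_def by (rule measurable_compose)
  qed
  have w_mult: "w (h \<otimes> g) = w g \<otimes>\<^bsub>BijGroup I\<^esub> w h" if "g \<in> carrier G" "h \<in> carrier G" for g h
    unfolding w_def using that
    by (simp add: inv_mult_group left_mult_perm_mult[OF L_subgroup] conj_bij_mult[OF bij_b] left_mult_perm_Bij[OF L_subgroup])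
  have "AE x in M. \<forall>y z. (x, y) \<in> R \<longrightarrow> (y, z) \<in> R \<longrightarrow> \<Omega> (x, z) = \<Omega> (x, y) \<otimes>\<^bsub>BijGroup I\<^esub> \<Omega> (y, z)"
    using AE_free_point
  proof (eventually_elim, intro allI impI)
    fix x y z assume x: "free_point x" and xy: "(x, y) \<in> R" and yz: "(y, z) \<in> R"
    obtain g where g: "g \<in> carrier G" "y = \<phi> g x" using xy by (auto simp: orbit_relation_iff)
    obtain h where h: "h \<in> carrier G" "z = \<phi> h y" using yz by (auto simp: orbit_relation_iff)
    have "z = \<phi> (h \<otimes> g) x" using g h free_point_space[OF x] by (simp add: act_mult)
    then have "\<Omega> (x, z) = w (h \<otimes> g)" using g h \<Omega>_free[OF x] by simp
    moreover have "\<Omega> (x, y) = w g" using g \<Omega>_free[OF x] by simp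
    moreover have "\<Omega> (y, z) = w h" unfolding h(2) g(2) using g h \<Omega>_free free_point_act[OF x] by simp
    ultimately show "\<Omega> (x, z) = \<Omega> (x, y) \<otimes>\<^bsub>BijGroup I\<^esub> \<Omega> (y, z)"
      using g h w_mult by simp
  qed
  then have cocycle: "cocycle M R (BijGroup I) (Sym_topology I) \<Omega>"
    unfolding cocycle_def using meas by simp
  have "AE x in M. \<forall>y. (x, y) \<in> R \<longrightarrow>
      (\<forall>i\<in>I. \<forall>j\<in>I. \<Omega> (x, y) i = j \<longleftrightarrow> S `` {c j x} = S `` {c i y})"
    using AE_free_point
  proof (eventually_elim, intro allI impI ballI)
    fix x y i j assume x: "free_point x" and xy: "(x, y) \<in> R" and ij: "i \<in> I" "j \<in> I"
    obtain h where h: "h \<in> carrier G" "y = \<phi> h x" using xy by (auto simp: orbit_relation_iff)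
    have "c i y = \<phi> (inv (r (\<theta> i)) \<otimes> h) x"
      unfolding c_def using h rG[OF ij(1)] free_point_space[OF x] by (simp add: act_mult)
    then have "S `` {c j x} = S `` {c i y} \<longleftrightarrow> \<theta> j = inv (inv (r (\<theta> i)) \<otimes> h) <# L"
      using c_class[OF x ij(2), of "inv (r (\<theta> i)) \<otimes> h"] rG[OF ij(1)] h by simp
    also have "inv (inv (r (\<theta> i)) \<otimes> h) <# L = inv h <# \<theta> i"
      using rG[OF ij(1)] rL[OF ij(1)] h lcos_translate[OF L_subgroup, of "inv h" "r (\<theta> i)"]
      by (simp add: inv_mult_group)
    also have "\<dots> = \<theta> (\<Omega> (x, y) i)"
      using w_apply[OF h(1) ij(1)] \<Omega>_free[OF x h(1)] h by simp
    also have "\<theta> j = \<theta> (\<Omega> (x, y) i) \<longleftrightarrow> \<Omega> (x, y) i = j"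
      using b_\<theta> ij Bij_apply[OF \<Omega>_Bij ij(1)] by metis
    finally show "\<Omega> (x, y) i = j \<longleftrightarrow> S `` {c j x} = S `` {c i y}" by simp
  qed
  then have "index_cocycle M S R I c \<Omega>"
    unfolding index_cocycle_def using family cocycle by simp
  moreover have "invariant_sets M {p \<in> R. \<Omega> p \<in> K} = invariant_sets M R"
    if "subgroup K (BijGroup I)" "openin (Sym_topology I) K" for K
  proof (rule invariant_sets_of_constant_conjugacy[OF bij \<Omega>_Bij _ that])
    show "AE x in M. \<forall>h\<in>carrier G. \<forall>i\<in>I. \<theta> (\<Omega> (x, \<phi> h x) i) = inv h <# \<theta> i"
      using AE_free_point by eventually_elim (simp add: \<Omega>_free w_apply)
  qed
  ultimately have "ergodic_index_cocycle M S R I c \<Omega>"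
    unfolding ergodic_index_cocycle_def ergodic_cocycle_def using cocycle by blast
  then show ?thesis
    unfolding aperiodic_inclusion_def
    using pmp_equiv_rel_orbit_relation ergodic_rel_S ergodic_rel_R S_subset_R
      pmp_action_of_countable_group.pmp_equiv_rel_orbit_relation[OF S_action]
    by blast
qed

end


section \<open>The essential image of an ergodic index cocycle\<close>

locale action_ergodic_index_cocycle = free_aperiodic_action G M \<phi> L
  for G :: "('g, 'b) monoid_scheme" (structure) and M :: "'x measure" and \<phi> and L +
  fixes I :: "'i set" and c :: "'i \<Rightarrow> 'x \<Rightarrow> 'x" and \<Omega> :: "'x \<times> 'x \<Rightarrow> 'i \<Rightarrow> 'i"
  assumes erg: "ergodic_index_cocycle M (orbit_relation M (restrict_group G L) \<phi>)
    (orbit_relation M G \<phi>) I c \<Omega>"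
begin

lemma index_countable: "countable I"
  and index_in_full_group: "i \<in> I \<Longrightarrow> c i \<in> full_group M R"
  and AE_index_partition:
    "AE x in M. R `` {x} = (\<Union>i\<in>I. S `` {c i x}) \<and> disjoint_family_on (\<lambda>i. S `` {c i x}) I"
  using erg by (auto simp: ergodic_index_cocycle_def index_cocycle_def index_family_def)

lemma measurable_index: "i \<in> I \<Longrightarrow> c i \<in> measurable M M"
  using index_in_full_group by (auto simp: full_group_def borel_automorphism_def)

lemma index_orbit: "i \<in> I \<Longrightarrow> x \<in> space M \<Longrightarrow> \<exists>g\<in>carrier G. c i x = \<phi> g x"
  using index_in_full_group by (auto simp: full_group_def orbit_relation_iff)

lemma cocycle_Bij: "p \<in> R \<Longrightarrow> \<Omega> p \<in> Bij I"
proof -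
  assume p: "p \<in> R"
  have meas: "\<Omega> \<in> measurable (restrict_space (M \<Otimes>\<^sub>M M) R) (borel_of_topology (Sym_topology I))"
    using erg by (simp add: ergodic_index_cocycle_def ergodic_cocycle_def cocycle_def)
  have "p \<in> space (restrict_space (M \<Otimes>\<^sub>M M) R)"
    using p sets.sets_into_space[OF orbit_relation_sets] by (auto simp: space_restrict_space)
  from measurable_space[OF meas this] show "\<Omega> p \<in> Bij I" by simp
qed

lemma invariant_sets_open_subgroup:
  assumes "subgroup K (BijGroup I)" "openin (Sym_topology I) K"
  shows "invariant_sets M {p \<in> R. \<Omega> p \<in> K} = invariant_sets M R"
  using erg assms unfolding ergodic_index_cocycle_def ergodic_cocycle_def by blast

definition typical_point :: "'x \<Rightarrow> bool" where
  "typical_point x \<longleftrightarrow> free_point x \<and>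
     R `` {x} = (\<Union>i\<in>I. S `` {c i x}) \<and> disjoint_family_on (\<lambda>i. S `` {c i x}) I \<and>
     (\<forall>y. (x, y) \<in> R \<longrightarrow> (\<forall>i\<in>I. \<forall>j\<in>I. \<Omega> (x, y) i = j \<longleftrightarrow> S `` {c j x} = S `` {c i y}))"

lemma AE_typical_point: "AE x in M. typical_point x"
proof -
  have "AE x in M. \<forall>y. (x, y) \<in> R \<longrightarrow> (\<forall>i\<in>I. \<forall>j\<in>I. \<Omega> (x, y) i = j \<longleftrightarrow> S `` {c j x} = S `` {c i y})"
    using erg by (simp add: ergodic_index_cocycle_def index_cocycle_def)
  with AE_free_point AE_index_partition show ?thesis
    by eventually_elim (simp add: typical_point_def)
qed

lemma typical_point_free: "typical_point x \<Longrightarrow> free_point x"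
  by (simp add: typical_point_def)

lemma typical_point_cocycle:
  assumes "typical_point x" "(x, y) \<in> R" "i \<in> I" "j \<in> I"
  shows "\<Omega> (x, y) i = j \<longleftrightarrow> S `` {c j x} = S `` {c i y}"
  using assms unfolding typical_point_def by blast

text \<open>At points with trivial stabilizer these are the fibres of \<open>label\<close> below; the existential form makes them
  measurable subsets of the whole space.\<close>

definition label_set :: "'i \<Rightarrow> 'g set \<Rightarrow> 'x set" where
  "label_set i C = {x \<in> space M. \<exists>g\<in>carrier G. C = inv g <# L \<and> c i x = \<phi> g x}"

text \<open>This is the transfer function \<open>\<theta>\<^sub>x\<close>, meaningful at points with trivial stabilizer.\<close>

definition label :: "'x \<Rightarrow> 'i \<Rightarrow> 'g set" where
  "label x i = (THE C. x \<in> label_set i C)"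

lemma label_eq:
  assumes x: "free_point x" and g: "g \<in> carrier G" "c i x = \<phi> g x"
  shows "label x i = inv g <# L"
  unfolding label_def
proof (rule the_equality)
  show "x \<in> label_set i (inv g <# L)"
    using g free_point_space[OF x] by (auto simp: label_set_def)
  show "C = inv g <# L" if "x \<in> label_set i C" for C
    using that free_point_inj[OF x] g by (auto simp: label_set_def)
qed

lemma label_closed:
  assumes "free_point x" "i \<in> I"
  shows "label x i \<in> J"
proof -
  obtain g where "g \<in> carrier G" "c i x = \<phi> g x"
    using index_orbit[OF assms(2) free_point_space[OF assms(1)]] by auto
  then show ?thesis using label_eq[OF assms(1)] lcosetsI by simp
qed

lemma mem_label_set_iff:
  assumes "free_point x" "i \<in> I"
  shows "x \<in> label_set i C \<longleftrightarrow> label x i = C"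
proof -
  obtain g where g: "g \<in> carrier G" "c i x = \<phi> g x"
    using index_orbit[OF assms(2) free_point_space[OF assms(1)]] by auto
  show ?thesis
  proof
    assume "x \<in> label_set i C"
    then show "label x i = C" using label_eq[OF assms(1)] by (auto simp: label_set_def)
  next
    assume "label x i = C"
    then show "x \<in> label_set i C"
      using label_eq[OF assms(1) g] g free_point_space[OF assms(1)] by (auto simp: label_set_def)
  qed
qed

lemma label_set_sets:
  assumes "i \<in> I"
  shows "label_set i C \<in> sets M"
proof -
  have "label_set i C = (\<Union>g\<in>{g \<in> carrier G. C = inv g <# L}. {x \<in> space M. c i x = \<phi> g x})"
    by (auto simp: label_set_def)
  moreover have "countable {g \<in> carrier G. C = inv g <# L}"
    using countable_group by (rule countable_subset[rotated]) auto
  ultimately show ?thesis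
    using standard_prob_space_equalizer[OF standard measurable_index[OF assms] measurable_act]
    by (auto intro!: sets.countable_UN'')
qed

lemma index_class_eq_iff:
  assumes x: "free_point x" and i: "i \<in> I" and h: "h \<in> carrier G"
  shows "S `` {c i x} = S `` {\<phi> h x} \<longleftrightarrow> label x i = inv h <# L"
proof -
  obtain g where g: "g \<in> carrier G" "c i x = \<phi> g x"
    using index_orbit[OF i free_point_space[OF x]] by auto
  show ?thesis
    using S_class_eq_iff[OF x g(1) h] label_eq[OF x g] g(2) by simp
qed

text \<open>Injectivity is disjointness of the classes of the \<open>c i x\<close>, surjectivity is that they exhaust the orbit
  of \<open>x\<close>.\<close>

lemma bij_betw_label:
  assumes x: "typical_point x"
  shows "bij_betw (label x) I J"
proof -
  have free: "free_point x" using x by (rule typical_point_free)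
  have xs: "x \<in> space M" using free by (rule free_point_space)
  have "inj_on (label x) I"
  proof (rule inj_onI, rule ccontr)
    fix i j assume ij: "i \<in> I" "j \<in> I" "label x i = label x j" "i \<noteq> j"
    obtain g where g: "g \<in> carrier G" "c j x = \<phi> g x" using index_orbit[OF ij(2) xs] by auto
    have "S `` {c i x} = S `` {c j x}"
      using index_class_eq_iff[OF free ij(1) g(1)] label_eq[OF free g] ij(3) g(2) by simp
    moreover have "S `` {c i x} \<inter> S `` {c j x} = {}"
      using x ij by (auto simp: typical_point_def disjoint_family_on_def)
    moreover have "c j x \<in> S `` {c j x}"
      using equiv_S g xs by (auto simp: equiv_def refl_on_def act_space)
    ultimately show False by blast
  qed
  moreover have "label x ` I = J"
  proof
    show "label x ` I \<subseteq> J" using label_closed[OF free] by auto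
    show "J \<subseteq> label x ` I"
    proof
      fix C assume "C \<in> J"
      then obtain a where a: "a \<in> carrier G" "C = a <# L" by (rule lcosetsE)
      have "\<phi> (inv a) x \<in> R `` {x}" using a xs by (auto simp: orbit_relation_iff)
      also have "R `` {x} = (\<Union>i\<in>I. S `` {c i x})" using x by (simp add: typical_point_def)
      finally obtain i where i: "i \<in> I" "(c i x, \<phi> (inv a) x) \<in> S" by blast
      then have "S `` {c i x} = S `` {\<phi> (inv a) x}"
        using equiv_class_eq[OF equiv_S] by blast
      then have "label x i = C"
        using index_class_eq_iff[OF free i(1), of "inv a"] a by simp
      then show "C \<in> label x ` I" using i(1) by blast
    qed
  qed
  ultimately show ?thesis by (simp add: bij_betw_def)
qed

text \<open>Write \<open>c i (\<phi> h x) = \<phi> g (\<phi> h x)\<close>. Its class, seen from \<open>x\<close>, has label \<open>(g h)\<inverse> L\<close>, whereas seen from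
  \<open>\<phi> h x\<close> it has label \<open>g\<inverse> L\<close>.\<close>

lemma label_cocycle:
  assumes x: "typical_point x" and h: "h \<in> carrier G" and i: "i \<in> I"
  shows "label x (\<Omega> (x, \<phi> h x) i) = inv h <# label (\<phi> h x) i"
proof -
  have free: "free_point x" using x by (rule typical_point_free)
  have xs: "x \<in> space M" using free by (rule free_point_space)
  let ?y = "\<phi> h x"
  have free_y: "free_point ?y" using free h by (rule free_point_act)
  have R: "(x, ?y) \<in> R" using h xs by (auto simp: orbit_relation_iff)
  define j where "j = \<Omega> (x, ?y) i"
  have j: "j \<in> I" unfolding j_def using Bij_apply[OF cocycle_Bij[OF R] i] .
  have class_eq: "S `` {c j x} = S `` {c i ?y}"
    using typical_point_cocycle[OF x R i j] by (simp add: j_def)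
  obtain g where g: "g \<in> carrier G" "c i ?y = \<phi> g ?y"
    using index_orbit[OF i free_point_space[OF free_y]] by auto
  have "c i ?y = \<phi> (g \<otimes> h) x" using g h xs by (simp add: act_mult)
  then have "label x j = inv (g \<otimes> h) <# L"
    using index_class_eq_iff[OF free j, of "g \<otimes> h"] class_eq g h by simp
  also have "\<dots> = inv h <# (inv g <# L)"
    using g h by (simp add: inv_mult_group lcos_translate[OF L_subgroup])
  also have "\<dots> = inv h <# label ?y i"
    using label_eq[OF free_y g] by simp
  finally show ?thesis by (simp add: j_def)
qed

definition cylinder :: "'i set \<Rightarrow> ('i \<Rightarrow> 'g set) \<Rightarrow> 'x set" where
  "cylinder F \<beta> = {x \<in> space M. \<forall>i\<in>F. x \<in> label_set i (\<beta> i)}"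

lemma cylinder_sets:
  assumes "finite F" "F \<subseteq> I"
  shows "cylinder F \<beta> \<in> sets M"
proof (cases "F = {}")
  case False
  have "cylinder F \<beta> = (\<Inter>i\<in>F. label_set i (\<beta> i))"
    using False by (auto simp: cylinder_def label_set_def)
  then show ?thesis using False assms label_set_sets by (auto intro!: sets.finite_INT)
qed (simp add: cylinder_def)

lemma mem_cylinder_iff:
  assumes "free_point x" "F \<subseteq> I"
  shows "x \<in> cylinder F \<beta> \<longleftrightarrow> (\<forall>i\<in>F. label x i = \<beta> i)"
  using assms free_point_space[OF assms(1)] mem_label_set_iff[OF assms(1)]
  by (auto simp: cylinder_def subset_iff)

text \<open>A point whose labelling is not exceptional: on each finite set of indices it is shared by a set of points
  of positive measure.\<close>

definition base_point :: "'x \<Rightarrow> bool" where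
  "base_point x \<longleftrightarrow> typical_point x \<and>
     (\<forall>F. finite F \<longrightarrow> F \<subseteq> I \<longrightarrow> emeasure M (cylinder F (label x)) \<noteq> 0)"

text \<open>There are countably many cylinders \<open>cylinder F \<beta>\<close> with \<open>F\<close> finite and \<open>\<beta>\<close> extensional, and almost every
  point avoids those among them that are null.\<close>

lemma ex_base_point: "\<exists>x. base_point x"
proof -
  define P where "P = (SIGMA F:{F. finite F \<and> F \<subseteq> I}. Pi\<^sub>E F (\<lambda>_. J))"
  have J_countable: "countable J" using countable_group by (simp add: LCOSETS_def)
  have "countable P"
    unfolding P_def using index_countable J_countable
    by (intro countable_SIGMA countable_Collect_finite_subset countable_PiE) auto
  have "AE x in M. \<forall>p\<in>P. x \<in> cylinder (fst p) (snd p) \<longrightarrow> emeasure M (cylinder (fst p) (snd p)) \<noteq> 0"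
  proof (intro AE_ball_countable[THEN iffD2, OF \<open>countable P\<close>] ballI)
    fix p assume "p \<in> P"
    then have meas: "cylinder (fst p) (snd p) \<in> sets M"
      by (intro cylinder_sets) (auto simp: P_def)
    show "AE x in M. x \<in> cylinder (fst p) (snd p) \<longrightarrow> emeasure M (cylinder (fst p) (snd p)) \<noteq> 0"
    proof (cases "emeasure M (cylinder (fst p) (snd p)) = 0")
      case True
      then have "AE x in M. x \<notin> cylinder (fst p) (snd p)" using meas by (intro AE_not_in) auto
      then show ?thesis by eventually_elim simp
    qed simp
  qed
  with AE_typical_point have "AE x in M. base_point x"
  proof eventually_elim
    case (elim x)
    have free: "free_point x" using elim(1) by (rule typical_point_free)
    have "emeasure M (cylinder F (label x)) \<noteq> 0" if F: "finite F" "F \<subseteq> I" for F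
    proof -
      have "(F, restrict (label x) F) \<in> P"
        unfolding P_def using F label_closed[OF free] by auto
      moreover have "cylinder F (restrict (label x) F) = cylinder F (label x)"
        by (auto simp: cylinder_def)
      moreover have "x \<in> cylinder F (label x)"
        using mem_cylinder_iff[OF free F(2)] by simp
      ultimately show ?thesis using elim(2) by fastforce
    qed
    then show ?case using elim(1) by (simp add: base_point_def)
  qed
  show ?thesis
  proof (rule ccontr)
    assume no: "\<not> ?thesis"
    from \<open>AE x in M. base_point x\<close> have "AE x in M. False"
      by eventually_elim (use no in auto)
    then show False by simp
  qed
qed

context
  fixes x0 assumes x0: "base_point x0"
begin

abbreviation (input) "label0 \<equiv> label x0"

lemma free_x0: "free_point x0" and bij_label0: "bij_betw label0 I J"
  and cylinder_pos: "finite F \<Longrightarrow> F \<subseteq> I \<Longrightarrow> emeasure M (cylinder F label0) \<noteq> 0"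
  using x0 typical_point_free bij_betw_label by (auto simp: base_point_def)

text \<open>Let \<open>A\<close> be the set of points where the conclusion holds. If \<open>\<Omega> (x, y)\<close> fixes \<open>F\<close> pointwise, then
  \<open>label_cocycle\<close> shows that the labels of \<open>x\<close> and \<open>y\<close> on \<open>F\<close> are translates of each other, so \<open>A\<close> is
  invariant under that part of the relation. Ergodicity of \<open>\<Omega>\<close> makes \<open>A\<close> null or conull, and it contains a
  cylinder around \<open>x0\<close>.\<close>

lemma AE_label_translate:
  assumes F: "finite F" "F \<subseteq> I"
  shows "AE x in M. \<exists>g\<in>carrier G. \<forall>i\<in>F. label x i = g <# label0 i"
proof -
  define A where "A = (\<Union>g\<in>carrier G. cylinder F (\<lambda>i. g <# label0 i))"
  have A: "A \<in> sets M"
    unfolding A_def using countable_group cylinder_sets[OF F] by (intro sets.countable_UN'') auto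
  have A_iff: "x \<in> A \<longleftrightarrow> (\<exists>g\<in>carrier G. \<forall>i\<in>F. label x i = g <# label0 i)" if "free_point x" for x
    using mem_cylinder_iff[OF that F(2)] by (auto simp: A_def)
  let ?K = "{f \<in> Bij I. \<forall>i\<in>F. f i = i}"
  have "AE x in M. \<forall>y. (x, y) \<in> {p \<in> R. \<Omega> p \<in> ?K} \<longrightarrow> (x \<in> A \<longleftrightarrow> y \<in> A)"
    using AE_typical_point
  proof (eventually_elim, intro allI impI)
    fix x y assume x: "typical_point x" and xy: "(x, y) \<in> {p \<in> R. \<Omega> p \<in> ?K}"
    then obtain h where h: "h \<in> carrier G" "y = \<phi> h x" by (auto simp: orbit_relation_iff)
    have free: "free_point x" using x by (rule typical_point_free)
    have free_y: "free_point y" using free_point_act[OF free h(1)] h(2) by simp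
    have xy_eq: "label x i = inv h <# label y i" if "i \<in> F" for i
      using label_cocycle[OF x h(1), of i] xy h that F(2) by auto
    have yx_eq: "label y i = h <# label x i" if "i \<in> F" for i
    proof -
      have "i \<in> I" using that F(2) by auto
      then show ?thesis
        using xy_eq[OF that] lcos_translate_inv_eq[OF L_subgroup h(1) label_closed[OF free_y] label_closed[OF free]]
        by metis
    qed
    have translate: "\<exists>g\<in>carrier G. \<forall>i\<in>F. label z i = g <# label0 i"
      if g: "g \<in> carrier G" "\<forall>i\<in>F. label w i = g <# label0 i"
        and k: "k \<in> carrier G" "\<And>i. i \<in> F \<Longrightarrow> label z i = k <# label w i" for w z g k
    proof (rule bexI[of _ "k \<otimes> g"], intro ballI)
      fix i assume "i \<in> F"
      then show "label z i = (k \<otimes> g) <# label0 i"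
        using g k label_closed[OF free_x0, of i] F(2) lcos_translate_mult[OF L_subgroup, of k g "label0 i"] by auto
    qed (use g k in auto)
    show "x \<in> A \<longleftrightarrow> y \<in> A"
      unfolding A_iff[OF free] A_iff[OF free_y]
    proof
      assume "\<exists>g\<in>carrier G. \<forall>i\<in>F. label x i = g <# label0 i"
      then obtain g where "g \<in> carrier G" "\<forall>i\<in>F. label x i = g <# label0 i" by blast
      then show "\<exists>g\<in>carrier G. \<forall>i\<in>F. label y i = g <# label0 i"
        using h(1) yx_eq by (rule translate)
    next
      assume "\<exists>g\<in>carrier G. \<forall>i\<in>F. label y i = g <# label0 i"
      then obtain g where "g \<in> carrier G" "\<forall>i\<in>F. label y i = g <# label0 i" by blast
      then show "\<exists>g\<in>carrier G. \<forall>i\<in>F. label x i = g <# label0 i"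
        using inv_closed[OF h(1)] xy_eq by (rule translate)
    qed
  qed
  then have "A \<in> invariant_sets M {p \<in> R. \<Omega> p \<in> ?K}"
    using A by (simp add: invariant_sets_def)
  also have "\<dots> = invariant_sets M R"
    by (rule invariant_sets_open_subgroup[OF subgroup_pointwise_stabilizer[OF F(2)]
          openin_pointwise_stabilizer[OF F]])
  finally have "measure M A = 0 \<or> measure M A = 1"
    using ergodic_rel_R by (simp add: ergodic_rel_def)
  moreover have "cylinder F label0 \<subseteq> A"
  proof -
    have "cylinder F (\<lambda>i. \<one> <# label0 i) = cylinder F label0"
      using lcos_translate_one[OF L_subgroup] label_closed[OF free_x0] F(2) by (auto simp: cylinder_def subset_iff)
    then show ?thesis unfolding A_def by blast
  qed
  then have "emeasure M A \<noteq> 0"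
    using emeasure_mono[OF _ A] cylinder_pos[OF F] by (metis le_zero_eq)
  ultimately have "AE x in M. x \<in> A"
    using A by (simp add: prob_eq_1 emeasure_eq_measure)
  with AE_free_point show ?thesis
    by eventually_elim (simp add: A_iff)
qed

definition conj_completion :: "('i \<Rightarrow> 'i) set" where
  "conj_completion = {f \<in> Bij I. conj_bij I J label0 f \<in> relative_profinite_completion G L}"

lemma mem_conj_completion_iff:
  "f \<in> conj_completion \<longleftrightarrow> f \<in> Bij I \<and>
     (\<forall>F. finite F \<longrightarrow> F \<subseteq> I \<longrightarrow> (\<exists>g\<in>carrier G. \<forall>i\<in>F. g <# label0 i = label0 (f i)))"
proof -
  have eq: "(\<forall>E. finite E \<longrightarrow> E \<subseteq> J \<longrightarrow> (\<exists>g\<in>carrier G. \<forall>C\<in>E. g <# C = conj_bij I J label0 f C)) \<longleftrightarrow>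
      (\<forall>F. finite F \<longrightarrow> F \<subseteq> I \<longrightarrow> (\<exists>g\<in>carrier G. \<forall>i\<in>F. g <# label0 i = label0 (f i)))"
    (is "?A \<longleftrightarrow> ?B")
  proof
    assume A: ?A
    show ?B
    proof (intro allI impI)
      fix F assume F: "finite F" "F \<subseteq> I"
      have "finite (label0 ` F)" "label0 ` F \<subseteq> J"
        using F label_closed[OF free_x0] by auto
      then obtain g where g: "g \<in> carrier G" "\<forall>C\<in>label0 ` F. g <# C = conj_bij I J label0 f C"
        using A by metis
      have "g <# label0 i = label0 (f i)" if "i \<in> F" for i
        using g(2) that F(2) conj_bij_theta[OF bij_label0, of i f] by auto
      then show "\<exists>g\<in>carrier G. \<forall>i\<in>F. g <# label0 i = label0 (f i)" using g(1) by blast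
    qed
  next
    assume B: ?B
    show ?A
    proof (intro allI impI)
      fix E assume E: "finite E" "E \<subseteq> J"
      define F where "F = inv_into I label0 ` E"
      have F: "finite F" "F \<subseteq> I"
        unfolding F_def using E inv_theta_in[OF bij_label0] by auto
      then obtain g where g: "g \<in> carrier G" "\<forall>i\<in>F. g <# label0 i = label0 (f i)"
        using B by metis
      have "g <# C = conj_bij I J label0 f C" if C: "C \<in> E" for C
        using g(2) C E(2) theta_of_inv_theta[OF bij_label0, of C] by (auto simp: F_def conj_bij_def)
      then show "\<exists>g\<in>carrier G. \<forall>C\<in>E. g <# C = conj_bij I J label0 f C" using g(1) by blast
    qed
  qed
  then show ?thesis
    unfolding conj_completion_def mem_Collect_eq mem_relative_profinite_completion_iff[OF L_subgroup] eq
    by (cases "f \<in> Bij I") (simp_all only: conj_bij_Bij[OF bij_label0] simp_thms)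
qed

lemma closedin_conj_completion: "closedin (Sym_topology I) conj_completion"
proof -
  have "closedin (Sym_topology J) (relative_profinite_completion G L)"
    unfolding relative_profinite_completion_def by simp
  from closedin_continuous_map_preimage[OF continuous_map_conj_bij[OF bij_label0] this]
  show ?thesis by (simp add: conj_completion_def)
qed

text \<open>In \<open>\<Omega> (x, y) = \<theta>\<^sub>x\<inverse> \<circ> \<tau> (h\<inverse>) \<circ> \<theta>\<^sub>y\<close>, with \<open>y = \<phi> h x\<close>, both \<open>\<theta>\<^sub>x\<close> and \<open>\<theta>\<^sub>y\<close> are on each finite set
  translates of \<open>label x0\<close>.\<close>

lemma AE_cocycle_in_conj_completion:
  "AE x in M. \<forall>y. (x, y) \<in> R \<longrightarrow> \<Omega> (x, y) \<in> conj_completion"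
proof -
  have fin_countable: "countable {F. finite F \<and> F \<subseteq> I}"
    using index_countable by (rule countable_Collect_finite_subset)
  have "AE x in M. \<forall>F\<in>{F. finite F \<and> F \<subseteq> I}. \<exists>g\<in>carrier G. \<forall>i\<in>F. label x i = g <# label0 i"
    using AE_label_translate by (intro AE_ball_countable[THEN iffD2, OF fin_countable] ballI) auto
  then have translate: "AE x in M. \<forall>F. finite F \<longrightarrow> F \<subseteq> I \<longrightarrow> (\<exists>g\<in>carrier G. \<forall>i\<in>F. label x i = g <# label0 i)"
    by eventually_elim auto
  from AE_typical_point translate AE_orbit_relation[OF translate]
  show ?thesis
  proof (eventually_elim, intro allI impI)
    fix x y
    assume x: "typical_point x"
      and trans_x: "\<forall>F. finite F \<longrightarrow> F \<subseteq> I \<longrightarrow> (\<exists>g\<in>carrier G. \<forall>i\<in>F. label x i = g <# label0 i)"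
      and trans_orbit: "\<forall>y. (x, y) \<in> R \<longrightarrow>
        (\<forall>F. finite F \<longrightarrow> F \<subseteq> I \<longrightarrow> (\<exists>g\<in>carrier G. \<forall>i\<in>F. label y i = g <# label0 i))"
      and xy: "(x, y) \<in> R"
    obtain h where h: "h \<in> carrier G" "y = \<phi> h x" using xy by (auto simp: orbit_relation_iff)
    have B: "\<Omega> (x, y) \<in> Bij I" using cocycle_Bij[OF xy] .
    have "\<exists>g\<in>carrier G. \<forall>i\<in>F. g <# label0 i = label0 (\<Omega> (x, y) i)" if F: "finite F" "F \<subseteq> I" for F
    proof -
      obtain k where k: "k \<in> carrier G" "\<forall>i\<in>F. label y i = k <# label0 i"
        using trans_orbit xy F by metis
      have "finite (\<Omega> (x, y) ` F)" "\<Omega> (x, y) ` F \<subseteq> I" using F Bij_apply[OF B] by auto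
      then obtain m where m: "m \<in> carrier G" "\<forall>i\<in>\<Omega> (x, y) ` F. label x i = m <# label0 i"
        using trans_x by metis
      have "(inv m \<otimes> (inv h \<otimes> k)) <# label0 i = label0 (\<Omega> (x, y) i)" if i: "i \<in> F" for i
      proof -
        have iI: "i \<in> I" "\<Omega> (x, y) i \<in> I" using i F(2) Bij_apply[OF B] by auto
        have J: "label0 i \<in> J" "label0 (\<Omega> (x, y) i) \<in> J"
          using iI label_closed[OF free_x0] by auto
        have "m <# label0 (\<Omega> (x, y) i) = label x (\<Omega> (x, y) i)" using m(2) i by auto
        also have "\<dots> = inv h <# label y i" using label_cocycle[OF x h(1) iI(1)] h(2) by simp
        also have "\<dots> = inv h <# (k <# label0 i)" using k(2) i by simp
        also have "\<dots> = (inv h \<otimes> k) <# label0 i"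
          using h k J by (simp add: lcos_translate_mult[OF L_subgroup])
        finally have eq: "m <# label0 (\<Omega> (x, y) i) = (inv h \<otimes> k) <# label0 i" .
        then have "inv m <# ((inv h \<otimes> k) <# label0 i) = label0 (\<Omega> (x, y) i)"
          using lcos_translate_inv_eq[OF L_subgroup m(1) _ J(2)] lcos_translate_closed[OF L_subgroup _ J(1)] h k by simp
        then show ?thesis
          using h k m J by (simp add: lcos_translate_mult[OF L_subgroup])
      qed
      then show ?thesis using h k m by (intro bexI[of _ "inv m \<otimes> (inv h \<otimes> k)"]) auto
    qed
    then show "\<Omega> (x, y) \<in> conj_completion" using B by (simp add: mem_conj_completion_iff)
  qed
qed

text \<open>Suppose \<open>f\<close> is in the conjugate but not in \<open>F\<close>; then all permutations that agree with \<open>f\<close> on some finite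
  set \<open>E\<close> avoid \<open>F\<close>. On \<open>E\<close> the permutation \<open>f\<close> is, in terms of the labels of \<open>x0\<close>, a translation by some
  \<open>g\<close>. If \<open>x\<close> has the labels of \<open>x0\<close> on \<open>f ` E\<close> and \<open>\<phi> h x\<close> has them on \<open>E\<close>, where \<open>inv h\<close> is \<open>g\<close> times an
  element fixing the labels of \<open>E\<close>, then \<open>\<Omega> (x, \<phi> h x)\<close> agrees with \<open>f\<close> on \<open>E\<close>. For a suitable such \<open>h\<close> these
  \<open>x\<close> form a set of positive measure.\<close>

lemma conj_completion_least:
  assumes F: "closedin (Sym_topology I) F"
    and null: "rel_measure M {p \<in> R. \<Omega> p \<in> topspace (Sym_topology I) - F} = 0"
  shows "conj_completion \<subseteq> F"
proof (rule ccontr)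
  assume "\<not> conj_completion \<subseteq> F"
  then obtain f where f: "f \<in> conj_completion" "f \<notin> F" by auto
  have fB: "f \<in> Bij I" using f(1) by (simp add: mem_conj_completion_iff)
  have op: "openin (Sym_topology I) (Bij I - F)" using F by (simp add: closedin_def)
  have f_mem: "f \<in> Bij I - F" using fB f(2) by simp
  obtain E where E: "finite E" "E \<subseteq> I"
    "\<forall>f'\<in>Bij I. (\<forall>i\<in>E. f' i = f i) \<longrightarrow> f' \<in> Bij I - F"
    using bspec[OF conjunct2[OF openin_Sym_topology_iff[THEN iffD1, OF op]] f_mem] by (elim exE conjE)
  obtain g where g: "g \<in> carrier G" "\<forall>i\<in>E. g <# label0 i = label0 (f i)"
    using f(1) E(1,2) unfolding mem_conj_completion_iff by metis
  have fE: "finite (f ` E)" "f ` E \<subseteq> I" using E Bij_apply[OF fB] by auto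
  have EJ: "finite (label0 ` E)" "label0 ` E \<subseteq> J"
    using E label_closed[OF free_x0] by auto
  define H where "H = {l \<in> L. \<forall>C\<in>label0 ` E. l <# C = C}"
  have fin: "finite_index (restrict_group G L) H"
    unfolding H_def using finite_index_stabilizer_of_cosets[OF L_subgroup comm EJ] .
  then have "subgroup H (restrict_group G L)" by (simp add: finite_index_def)
  then have H: "subgroup H G" using incl_subgroup[OF L_subgroup] by blast
  have HG: "H \<subseteq> carrier G" using H by (rule subgroup.subset)
  let ?A1 = "cylinder (f ` E) label0" and ?A2 = "cylinder E label0"
  \<comment> \<open>substituting \<open>x = \<phi> g z\<close> reduces the search for \<open>h = s \<otimes> inv g\<close> to one for \<open>s\<close> in the ergodic group \<open>H\<close>\<close>
  define A where "A = \<phi> g -` ?A1 \<inter> space M"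
  have A: "A \<in> sets M" "emeasure M A \<noteq> 0"
    unfolding A_def using cylinder_sets[OF fE] cylinder_pos[OF fE] g(1)
    by (auto simp: emeasure_act intro: measurable_sets[OF measurable_act])
  obtain s where s: "s \<in> H" "emeasure M {z \<in> A. \<phi> s z \<in> ?A2} \<noteq> 0"
    using ergodic_subgroup_overlap[OF H ergodic_finite_index[OF fin] A cylinder_sets[OF E(1,2)] cylinder_pos[OF E(1,2)]]
    by blast
  have sG: "s \<in> carrier G" using s HG by auto
  define h where "h = s \<otimes> inv g"
  have h: "h \<in> carrier G" using sG g by (simp add: h_def)
  define D where "D = ?A1 \<inter> (\<phi> h -` ?A2 \<inter> space M)"
  have D: "D \<in> sets M"
    unfolding D_def using cylinder_sets[OF fE] cylinder_sets[OF E(1,2)] h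
    by (intro sets.Int measurable_sets[OF measurable_act]) auto
  have "{z \<in> A. \<phi> s z \<in> ?A2} = \<phi> g -` D \<inter> space M"
  proof -
    have "\<phi> h (\<phi> g z) = \<phi> s z" if "z \<in> space M" for z
      unfolding h_def using that sG g by (simp add: act_mult act_inv act_space)
    then show ?thesis using g act_space by (auto simp: A_def D_def)
  qed
  then have D_pos: "emeasure M D \<noteq> 0" using s(2) emeasure_act[OF g(1) D] by simp
  have "AE x in M. indicator D x \<le> emeasure (count_space UNIV) {y. (x, y) \<in> {p \<in> R. \<Omega> p \<in> topspace (Sym_topology I) - F}}"
    using AE_typical_point
  proof eventually_elim
    case (elim x)
    show ?case
    proof (cases "x \<in> D")
      case True
      have free: "free_point x" using elim by (rule typical_point_free)
      have xs: "x \<in> space M" using free by (rule free_point_space)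
      let ?y = "\<phi> h x"
      have free_y: "free_point ?y" using free h by (rule free_point_act)
      have R: "(x, ?y) \<in> R" using xs h by (auto simp: orbit_relation_iff)
      have B: "\<Omega> (x, ?y) \<in> Bij I" using cocycle_Bij[OF R] .
      have lx: "label x (f i) = label0 (f i)" if "i \<in> E" for i
        using True mem_cylinder_iff[OF free fE(2)] that by (auto simp: D_def)
      have ly: "label ?y i = label0 i" if "i \<in> E" for i
        using True mem_cylinder_iff[OF free_y E(2)] that by (auto simp: D_def)
      have "\<Omega> (x, ?y) i = f i" if i: "i \<in> E" for i
      proof -
        have iI: "i \<in> I" using i E(2) by auto
        have J: "label0 i \<in> J" using label_closed[OF free_x0 iI] .
        have "s <# label0 i = label0 i" using s(1) i by (auto simp: H_def)
        then have s_inv: "inv s <# label0 i = label0 i"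
          using lcos_translate_inv_eq[OF L_subgroup sG J J] by simp
        have "label x (\<Omega> (x, ?y) i) = inv h <# label0 i"
          using label_cocycle[OF elim h iI] ly[OF i] by simp
        also have "\<dots> = g <# (inv s <# label0 i)"
          using g sG J by (simp add: h_def inv_mult_group lcos_translate_mult[OF L_subgroup])
        also have "\<dots> = label x (f i)" using s_inv g(2) i lx[OF i] by simp
        finally show ?thesis
          using inj_onD[OF bij_betw_imp_inj_on[OF bij_betw_label[OF elim]]]
            Bij_apply[OF B iI] Bij_apply[OF fB iI] by blast
      qed
      then have "\<Omega> (x, ?y) \<in> Bij I - F" using E(3) B by blast
      then have "?y \<in> {y. (x, y) \<in> {p \<in> R. \<Omega> p \<in> topspace (Sym_topology I) - F}}" using R by simp
      then have "{?y} \<subseteq> {y. (x, y) \<in> {p \<in> R. \<Omega> p \<in> topspace (Sym_topology I) - F}}" by blast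
      from emeasure_mono[OF this, of "count_space UNIV"] show ?thesis
        using True by simp
    qed simp
  qed
  then have "(\<integral>\<^sup>+ x. indicator D x \<partial>M) \<le>
      rel_measure M {p \<in> R. \<Omega> p \<in> topspace (Sym_topology I) - F}"
    unfolding rel_measure_def by (rule nn_integral_mono_AE)
  then show False unfolding null using D D_pos by simp
qed

lemma essential_image_eq: "essential_image M R (Sym_topology I) \<Omega> = conj_completion"
  unfolding essential_image_def
proof (rule Least_equality)
  have "rel_measure M {p \<in> R. \<Omega> p \<in> topspace (Sym_topology I) - conj_completion} =
      (\<integral>\<^sup>+ x. 0 \<partial>M)"
    unfolding rel_measure_def
  proof (rule nn_integral_cong_AE)
    show "AE x in M. emeasure (count_space UNIV)
        {y. (x, y) \<in> {p \<in> R. \<Omega> p \<in> topspace (Sym_topology I) - conj_completion}} = 0"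
      using AE_cocycle_in_conj_completion
    proof eventually_elim
      case (elim x)
      then have "{y. (x, y) \<in> {p \<in> R. \<Omega> p \<in> topspace (Sym_topology I) - conj_completion}} = {}"
        by blast
      then show ?case by (simp only: emeasure_empty)
    qed
  qed
  then show "closedin (Sym_topology I) conj_completion \<and>
      rel_measure M {p \<in> R. \<Omega> p \<in> topspace (Sym_topology I) - conj_completion} = 0"
    using closedin_conj_completion by simp
qed (use conj_completion_least in blast)

end

theorem essential_image_isomorphic:
  "topological_group_isomorphic
     (restrict_group (BijGroup I) (essential_image M R (Sym_topology I) \<Omega>))
     (subtopology (Sym_topology I) (essential_image M R (Sym_topology I) \<Omega>))
     (restrict_group (BijGroup J) (relative_profinite_completion G L))
     (subtopology (Sym_topology J) (relative_profinite_completion G L))"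
proof -
  obtain x0 where x0: "base_point x0" using ex_base_point by blast
  show ?thesis
    unfolding essential_image_eq[OF x0] conj_completion_def[OF x0]
    by (intro topological_group_isomorphic_conj bij_label0[OF x0] subgroup_relative_profinite_completion L_subgroup)
qed

end

theorem proposition3p9:
  fixes \<Gamma> :: "('g, 'b) monoid_scheme" and \<Lambda> :: "'g set"
    and M :: "'x measure" and \<phi> :: "'g \<Rightarrow> 'x \<Rightarrow> 'x"
  assumes "group \<Gamma>" and "countable (carrier \<Gamma>)"
    and "commensurated \<Gamma> \<Lambda>"
    and "standard_prob_space M"
    and "pmp_action M \<Gamma> \<phi>" and "free_action M \<Gamma> \<phi>"
    and "aperiodic_action M (restrict_group \<Gamma> \<Lambda>) \<phi>"
  shows "aperiodic_inclusion M (orbit_relation M (restrict_group \<Gamma> \<Lambda>) \<phi>) (orbit_relation M \<Gamma> \<phi>) \<and>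
    (\<forall>(I :: 'i set) c \<Omega>.
       ergodic_index_cocycle M (orbit_relation M (restrict_group \<Gamma> \<Lambda>) \<phi>) (orbit_relation M \<Gamma> \<phi>) I c \<Omega> \<longrightarrow>
       topological_group_isomorphic
         (restrict_group (BijGroup I)
            (essential_image M (orbit_relation M \<Gamma> \<phi>) (Sym_topology I) \<Omega>))
         (subtopology (Sym_topology I)
            (essential_image M (orbit_relation M \<Gamma> \<phi>) (Sym_topology I) \<Omega>))
         (restrict_group (BijGroup (lcosets\<^bsub>\<Gamma>\<^esub> \<Lambda>)) (relative_profinite_completion \<Gamma> \<Lambda>))
         (subtopology (Sym_topology (lcosets\<^bsub>\<Gamma>\<^esub> \<Lambda>)) (relative_profinite_completion \<Gamma> \<Lambda>)))"
proof -
  have "free_aperiodic_action \<Gamma> M \<phi> \<Lambda>"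
    using assms
    by (simp add: free_aperiodic_action_def free_aperiodic_action_axioms_def
        pmp_action_of_countable_group_def pmp_action_of_countable_group_axioms_def)
  then interpret free_aperiodic_action \<Gamma> M \<phi> \<Lambda> .
  show ?thesis
  proof (intro conjI allI impI)
    fix I :: "'i set" and c \<Omega>
    assume "ergodic_index_cocycle M (orbit_relation M (restrict_group \<Gamma> \<Lambda>) \<phi>) (orbit_relation M \<Gamma> \<phi>) I c \<Omega>"
    then interpret action_ergodic_index_cocycle \<Gamma> M \<phi> \<Lambda> I c \<Omega>
      by unfold_locales
    show "topological_group_isomorphic
         (restrict_group (BijGroup I)
            (essential_image M (orbit_relation M \<Gamma> \<phi>) (Sym_topology I) \<Omega>))
         (subtopology (Sym_topology I)
            (essential_image M (orbit_relation M \<Gamma> \<phi>) (Sym_topology I) \<Omega>))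
         (restrict_group (BijGroup (lcosets\<^bsub>\<Gamma>\<^esub> \<Lambda>)) (relative_profinite_completion \<Gamma> \<Lambda>))
         (subtopology (Sym_topology (lcosets\<^bsub>\<Gamma>\<^esub> \<Lambda>)) (relative_profinite_completion \<Gamma> \<Lambda>))"
      by (rule essential_image_isomorphic)
  qed (rule aperiodic_inclusion_S_R)
qed

end
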